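(* Let $E\subset\mathbb{R}^n$ be a closed non-empty set with $|E|=0$ such that there exist constants $\sigma,C_0>0$ satisfying $$\mathcal{L}_{Q_0}(t)\leq\frac{C_0}{t^\sigma}\,\mathcal{S}_{Q_0}(t)$$ for every cube $Q_0\subset\mathbb{R}^n$ intersecting $E$ and every $t\in(0,1)$. Then, for every $1<p<\infty$, we have $\operatorname{dist}(\cdot,E)^{-\alpha}\in A_p$ whenever $0<\alpha<\min\{\sigma^{-1},(p-1)\sigma^{-1}\}$.
   Context: $|A|$ is the Lebesgue measure of $A$. A cube in $\mathbb{R}^n$ is a half-open set $Q=[a_1,b_1)\times\cdots\times[a_n,b_n)$ with $b_i-a_i>0$ the same for all $i$; this common value is the side length $l(Q)$. For a cube $Q_0$, $\mathcal{D}(Q_0)=\bigcup_{j\geq0}\mathcal{D}^j(Q_0)$, where $\mathcal{D}^j(Q_0)$ is the family of $2^{jn}$ pairwise disjoint cubes of side length $2^{-j}l(Q_0)$ whose union is $Q_0$. For $Q\in\mathcal{D}^j(Q_0)$ with $j\geq1$, $\pi Q$ is the unique cube of $\mathcal{D}^{j-1}(Q_0)$ containing $Q$. Define $\mathcal{D}_E(Q_0)=\{Q\in\mathcal{D}(Q_0): Q\cap\overline{E}=\emptyset,\ \pi Q\cap\overline{E}\neq\emptyset\}$. For a set $E$ with $|\overline{E}|=0$, a cube $Q_0$ intersecting $\overline{E}$ and $t\in(0,1)$, put $$\mathcal{L}_{Q_0}(t)=\max\Big\{L\geq0:\sum_{Q\in\mathcal{D}_E(Q_0),\,l(Q)\geq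 L}\tfrac{|Q|}{|Q_0|}\geq t\Big\},\qquad \mathcal{S}_{Q_0}(t)=\min\Big\{L\geq0:\sum_{Q\in\mathcal{D}_E(Q_0),\,l(Q)\leq L}\tfrac{|Q|}{|Q_0|}\geq t\Big\}$$ (these exist and are positive). $\operatorname{dist}(x,E)=\inf_{e\in E}|x-e|$; negative powers of $0$ equal $+\infty$. A weight is a locally integrable function $w$ on $\mathbb{R}^n$ with $w>0$ a.e. For $1<p<\infty$, $w\in A_p$ means that $w$ is a weight and there is $C>0$ with $\left(\frac{1}{|Q|}\int_Q w\right)\left(\frac{1}{|Q|}\int_Q w^{-\frac{1}{p-1}}\right)^{p-1}\leq C$ for every cube $Q\subset\mathbb{R}^n$. *)

theory Defs
  imports "HOL-Analysis.Analysis"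
begin

definition cube :: "real ^ 'n \<Rightarrow> real \<Rightarrow> (real ^ 'n) set" where
  "cube a l = {x. \<forall>i. a $ i \<le> x $ i \<and> x $ i < a $ i + l}"

definition cubes :: "(real ^ 'n) set set" where
  "cubes = {cube a l | a l. l > 0}"

definition side_length :: "(real ^ 'n) set \<Rightarrow> real" where
  "side_length Q = (THE l. l > 0 \<and> (\<exists>a. Q = cube a l))"

text \<open>The members of generation \<open>j\<close> are the \<open>2^(j * n)\<close> cells of the uniform grid of mesh
  \<open>l / 2^j\<close>; corner and side of \<open>Q0\<close> are determined by \<open>Q0\<close> (see \<open>cube_eq_iff\<close>).\<close>

definition dyadic_gen :: "nat \<Rightarrow> (real ^ 'n) set \<Rightarrow> (real ^ 'n) set set" where
  "dyadic_gen j Q0 =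
     {cube (\<chi> i. a $ i + real (k i) * (l / 2 ^ j)) (l / 2 ^ j) | a l k.
        l > 0 \<and> Q0 = cube a l \<and> (\<forall>i. k i < 2 ^ j)}"

definition dyadic :: "(real ^ 'n) set \<Rightarrow> (real ^ 'n) set set" where
  "dyadic Q0 = (\<Union>j. dyadic_gen j Q0)"

definition dyadic_parent :: "(real ^ 'n) set \<Rightarrow> (real ^ 'n) set \<Rightarrow> (real ^ 'n) set" where
  "dyadic_parent Q0 Q =
     (THE P. \<exists>j. Q \<in> dyadic_gen (Suc j) Q0 \<and> P \<in> dyadic_gen j Q0 \<and> Q \<subseteq> P)"

text \<open>The cube \<open>Q0\<close> itself has no parent, so it is excluded.\<close>

definition dyadic_avoiding :: "(real ^ 'n) set \<Rightarrow> (real ^ 'n) set \<Rightarrow> (real ^ 'n) set set" where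
  "dyadic_avoiding E Q0 =
     {Q \<in> dyadic Q0 - {Q0}. Q \<inter> closure E = {} \<and> dyadic_parent Q0 Q \<inter> closure E \<noteq> {}}"

definition L_large :: "(real ^ 'n) set \<Rightarrow> (real ^ 'n) set \<Rightarrow> real \<Rightarrow> real" where
  "L_large E Q0 t = (GREATEST L. L \<ge> 0 \<and>
     (\<Sum>\<^sub>\<infinity>Q \<in> {Q \<in> dyadic_avoiding E Q0. side_length Q \<ge> L}.
        measure lebesgue Q / measure lebesgue Q0) \<ge> t)"

definition S_small :: "(real ^ 'n) set \<Rightarrow> (real ^ 'n) set \<Rightarrow> real \<Rightarrow> real" where
  "S_small E Q0 t = (LEAST L. L \<ge> 0 \<and>
     (\<Sum>\<^sub>\<infinity>Q \<in> {Q \<in> dyadic_avoiding E Q0. side_length Q \<le> L}.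
        measure lebesgue Q / measure lebesgue Q0) \<ge> t)"

text \<open>Real powers on \<open>[0, \<infinity>]\<close>, with \<open>0\<close> to a negative power equal to \<open>\<infinity>\<close> and
  \<open>\<infinity>\<close> to a negative power equal to \<open>0\<close>.\<close>

definition ennpowr :: "ennreal \<Rightarrow> real \<Rightarrow> ennreal" where
  "ennpowr x s =
     (if s = 0 then 1
      else if x = 0 then (if s < 0 then \<infinity> else 0)
      else if x = \<infinity> then (if s < 0 then 0 else \<infinity>)
      else ennreal (enn2real x powr s))"

text \<open>Weights take values in \<open>[0, \<infinity>]\<close>, so that \<open>dist(x, E)\<close> to a negative power can be
  \<open>\<infinity>\<close> on \<open>E\<close> and averages are defined (possibly infinite) without integrability assumptions.\<close>

definition weight :: "(real ^ 'n \<Rightarrow> ennreal) \<Rightarrow> bool" where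
  "weight w \<longleftrightarrow> w \<in> borel_measurable lebesgue \<and>
     (\<forall>K. compact K \<longrightarrow> (\<integral>\<^sup>+x\<in>K. w x \<partial>lebesgue) < \<infinity>) \<and>
     (AE x in lebesgue. w x > 0)"

definition cube_average :: "(real ^ 'n) set \<Rightarrow> (real ^ 'n \<Rightarrow> ennreal) \<Rightarrow> ennreal" where
  "cube_average Q f = (\<integral>\<^sup>+x\<in>Q. f x \<partial>lebesgue) / emeasure lebesgue Q"

definition Muckenhoupt :: "real \<Rightarrow> (real ^ 'n \<Rightarrow> ennreal) set" where
  "Muckenhoupt p = {w. weight w \<and>
     (\<exists>C::real. C > 0 \<and> (\<forall>Q\<in>cubes.
        cube_average Q w *
        ennpowr (cube_average Q (\<lambda>x. ennpowr (w x) (- 1 / (p - 1)))) (p - 1) \<le> ennreal C))}"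

lemma cube_eq_iff:
  assumes "l > 0" "m > 0"
  shows "cube a l = cube b m \<longleftrightarrow> a = b \<and> l = m"
proof
  have *: "c $ i \<le> d $ i \<and> d $ i + v \<le> c $ i + u"
    if "u > 0" "v > 0" and sub: "cube d v \<subseteq> cube c u" for c d :: "real^'n" and u v i
  proof
    have "d \<in> cube d v" using that by (simp add: cube_def)
    then show "c $ i \<le> d $ i" using sub by (auto simp: cube_def)
    show "d $ i + v \<le> c $ i + u"
    proof (rule ccontr)
      assume neg: "\<not> ?thesis"
      define x where "x = (\<chi> j. if j = i then max (d $ i) (c $ i + u) else d $ j)"
      have "x \<in> cube d v" using neg that by (auto simp: cube_def x_def)
      then have "x \<in> cube c u" using sub by blast
      then have "x $ i < c $ i + u" by (simp add: cube_def)
      then show False by (simp add: x_def)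
    qed
  qed
  assume eq: "cube a l = cube b m"
  have "a $ i = b $ i \<and> l = m" for i
    using *[of l m b a i] *[of m l a b i] eq assms by auto
  then show "a = b \<and> l = m" by (simp add: vec_eq_iff)
qed auto

lemma side_length_cube: "l > 0 \<Longrightarrow> side_length (cube a l) = l"
  unfolding side_length_def by (rule the_equality) (auto simp: cube_eq_iff)

lemma dyadic_gen_cube:
  assumes "l > 0"
  shows "dyadic_gen j (cube a l) =
    (\<lambda>k. cube (\<chi> i. a $ i + real (k i) * (l / 2 ^ j)) (l / 2 ^ j)) ` {k. \<forall>i. k i < 2 ^ j}"
  using assms by (auto simp: dyadic_gen_def cube_eq_iff)

lemma side_length_dyadic_gen:
  assumes "Q0 \<in> cubes" "Q \<in> dyadic_gen j Q0"
  shows "Q \<in> cubes" "side_length Q = side_length Q0 / 2 ^ j"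
proof -
  obtain a l where Q0: "Q0 = cube a l" "l > 0" using assms by (auto simp: cubes_def)
  then obtain b where "Q = cube b (l / 2 ^ j)" using assms by (auto simp: dyadic_gen_cube)
  moreover have "l / 2 ^ j > 0" using Q0 by simp
  ultimately show "Q \<in> cubes" "side_length Q = side_length Q0 / 2 ^ j"
    using Q0 unfolding cubes_def by (blast, simp add: side_length_cube)
qed

lemma mem_grid_cell_iff:
  fixes s :: real
  assumes "s > 0"
  shows "a + real k * s \<le> x \<and> x < a + real k * s + s \<longleftrightarrow> \<lfloor>(x - a) / s\<rfloor> = int k"
  using assms by (auto simp: floor_eq_iff field_simps)

lemma card_dyadic_gen:
  fixes Q0 :: "(real ^ 'n) set"
  assumes "Q0 \<in> cubes"
  shows "card (dyadic_gen j Q0) = 2 ^ (j * CARD('n))"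
proof -
  obtain a l where Q0: "Q0 = cube a l" "l > 0" using assms by (auto simp: cubes_def)
  have "inj_on (\<lambda>k. cube (\<chi> i. a $ i + real (k i) * (l / 2 ^ j)) (l / 2 ^ j)) {k. \<forall>i. k i < 2 ^ j}"
    using Q0 by (auto simp: inj_on_def cube_eq_iff vec_eq_iff)
  moreover have "{k :: 'n \<Rightarrow> nat. \<forall>i. k i < 2 ^ j} = (UNIV :: 'n set) \<rightarrow>\<^sub>E {..<2 ^ j}"
    by (auto simp: PiE_def)
  ultimately show ?thesis
    using Q0 by (simp add: dyadic_gen_cube card_image card_PiE power_mult)
qed

lemma Union_dyadic_gen:
  assumes "Q0 \<in> cubes"
  shows "\<Union>(dyadic_gen j Q0) = Q0"
proof -
  obtain a l where Q0: "Q0 = cube a l" "l > 0" using assms by (auto simp: cubes_def)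
  define s where "s = l / 2 ^ j"
  have s: "s > 0" "l = 2 ^ j * s" using Q0 by (auto simp: s_def)
  have "x \<in> cube a l \<longleftrightarrow> (\<exists>k. (\<forall>i. k i < 2 ^ j) \<and> (\<forall>i. \<lfloor>(x $ i - a $ i) / s\<rfloor> = int (k i)))" for x
  proof -
    have "x \<in> cube a l \<longleftrightarrow> (\<forall>i. 0 \<le> (x $ i - a $ i) / s \<and> (x $ i - a $ i) / s < 2 ^ j)"
      using s by (auto simp: cube_def field_simps)
    also have "\<dots> \<longleftrightarrow> (\<forall>i. 0 \<le> \<lfloor>(x $ i - a $ i) / s\<rfloor> \<and> \<lfloor>(x $ i - a $ i) / s\<rfloor> < 2 ^ j)"
      by (simp add: floor_less_iff)
    also have "\<dots> \<longleftrightarrow> (\<forall>i. \<exists>k. k < 2 ^ j \<and> \<lfloor>(x $ i - a $ i) / s\<rfloor> = int k)"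
    proof -
      have "0 \<le> m \<and> m < 2 ^ j \<longleftrightarrow> (\<exists>k. k < 2 ^ j \<and> m = int k)" for m
        by (cases m) auto
      then show ?thesis by (simp only:)
    qed
    also have "\<dots> \<longleftrightarrow> (\<exists>k. \<forall>i. k i < 2 ^ j \<and> \<lfloor>(x $ i - a $ i) / s\<rfloor> = int (k i))"
      by (rule choice_iff)
    finally show ?thesis by (simp only: all_conj_distrib)
  qed
  then show ?thesis
    unfolding Q0(1) dyadic_gen_cube[OF Q0(2)] s_def[symmetric]
    by (simp only: set_eq_iff) (use s in \<open>simp add: cube_def mem_grid_cell_iff\<close>)
qed

lemma disjoint_dyadic_gen:
  assumes "Q0 \<in> cubes"
  shows "disjoint (dyadic_gen j Q0)"
proof -
  obtain a l where Q0: "Q0 = cube a l" "l > 0" using assms by (auto simp: cubes_def)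
  define s where "s = l / 2 ^ j"
  have s: "s > 0" using Q0 by (auto simp: s_def)
  show ?thesis
    unfolding Q0(1) dyadic_gen_cube[OF Q0(2)] s_def[symmetric]
    using s by (fastforce simp: disjoint_def cube_def mem_grid_cell_iff)
qed

end

theory Submission
  imports Defs
begin

text \<open>
  Let \<open>A j\<close> be the union of the generation-\<open>j\<close> subcubes of \<open>Q0\<close> that meet \<open>E\<close>, and \<open>f j = \<bar>A j\<bar> / \<bar>Q0\<bar>\<close>,
  which decreases from \<open>1\<close> to \<open>0\<close>. The members of \<open>dyadic_avoiding E Q0\<close> of generation at most \<open>j\<close> fill
  \<open>Q0 - A j\<close>, so \<open>L_large\<close> and \<open>S_small\<close> are determined by \<open>f\<close>. Let \<open>J\<close> be least with \<open>f J < 1/2\<close>. Comparing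
  the scale for a small \<open>t\<close> with the scale for \<open>t = 1/2\<close>, the hypothesis gives
  \<open>f j = O(2 powr ((J - j) / \<sigma>))\<close> and \<open>1 - f j = O(2 powr ((j - J) / \<sigma>))\<close>.

  Put \<open>\<rho> = l / 2 ^ J\<close> with \<open>l\<close> the side of \<open>Q0\<close>. On \<open>A j\<close> the distance to \<open>E\<close> is \<open>O(l / 2 ^ j)\<close>, and its
  positive power \<open>\<beta> < 1/\<sigma>\<close> has average \<open>O(\<rho> powr \<beta>)\<close> by the second estimate and a geometric series.
  Cubes of \<open>dyadic_avoiding E Q0\<close> may touch \<open>E\<close>, so the distance is not bounded below by their side; but a point of
  an inner subcube of \<open>Q0\<close> within \<open>l / 2 ^ j\<close> of \<open>E\<close> lies in one of the \<open>3 ^ n\<close> grid translates of \<open>A j\<close>,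
  and the first estimate gives the average \<open>O(\<rho> powr (- \<alpha>))\<close> of the negative power. The powers of \<open>\<rho>\<close> cancel in the
  \<open>A\<^sub>p\<close> product when \<open>\<beta> = \<alpha> / (p - 1)\<close>. On a cube whose fourfold enlargement misses \<open>E\<close> the distance is
  comparable to a constant.
\<close>

subsection \<open>Cells of the dyadic grid\<close>

text \<open>Indexing a grid cell by any of its points, through equal floors, makes "lies in the same
  cell" an equivalence relation and avoids carrying corner indices.\<close>

definition cell :: "real ^ 'n \<Rightarrow> real \<Rightarrow> real ^ 'n \<Rightarrow> (real ^ 'n) set" where
  "cell a h x = {y. \<forall>i. \<lfloor>(y $ i - a $ i) / h\<rfloor> = \<lfloor>(x $ i - a $ i) / h\<rfloor>}"

text \<open>This is the set \<open>A j\<close> of the overview, described by points instead of as a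
  union of dyadic cubes.\<close>

definition touched :: "(real ^ 'n) set \<Rightarrow> real ^ 'n \<Rightarrow> real \<Rightarrow> nat \<Rightarrow> (real ^ 'n) set" where
  "touched E a l j = {x \<in> cube a l. cell a (l / 2 ^ j) x \<inter> E \<noteq> {}}"

lemma cube_in_cubes: "l > 0 \<Longrightarrow> cube a l \<in> cubes"
  by (auto simp: cubes_def)

lemma self_mem_cell: "x \<in> cell a h x"
  by (simp add: cell_def)

lemma cell_eqI: "y \<in> cell a h x \<Longrightarrow> cell a h y = cell a h x"
  by (simp add: cell_def)

lemma cell_eq_cube:
  assumes "h > 0"
  shows "cell a h x = cube (\<chi> i. a $ i + of_int \<lfloor>(x $ i - a $ i) / h\<rfloor> * h) h"
proof -
  have "\<lfloor>(y - c) / h\<rfloor> = m \<longleftrightarrow> c + of_int m * h \<le> y \<and> y < c + of_int m * h + h" for y c m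
    using assms by (auto simp: floor_eq_iff field_simps)
  then show ?thesis by (auto simp: cell_def cube_def)
qed

lemma abs_diff_le_of_mem_cell:
  assumes "h > 0" "y \<in> cell a h x"
  shows "\<bar>x $ i - y $ i\<bar> \<le> h"
proof -
  have "x \<in> cell a h x" by (rule self_mem_cell)
  then show ?thesis using assms unfolding cell_eq_cube[OF assms(1)] cube_def
    by (auto dest!: spec[of _ i])
qed

lemma dist_le_of_mem_cell:
  fixes x :: "real ^ 'n" and h :: real
  assumes "h > 0" "y \<in> cell a h x"
  shows "dist x y \<le> CARD('n) * h"
proof -
  have "dist x y \<le> (\<Sum>i\<in>UNIV. \<bar>(x - y) $ i\<bar>)"
    unfolding dist_norm by (rule norm_le_l1_cart)
  also have "\<dots> \<le> (\<Sum>i\<in>(UNIV::'n set). h)"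
    by (rule sum_mono) (use abs_diff_le_of_mem_cell[OF assms] in simp)
  finally show ?thesis by simp
qed

text \<open>Links the indexed grid to cells: the corner of a dyadic cube is a point of
  \<open>cube a l\<close> and represents its cell; conversely, the floors of the rescaled
  coordinates of a point are the indices.\<close>

lemma dyadic_gen_eq_cells:
  assumes "l > 0"
  shows "dyadic_gen j (cube a l) = cell a (l / 2 ^ j) ` cube a l"
proof -
  define h where "h = l / 2 ^ j"
  have h: "h > 0" "l = 2 ^ j * h" using assms by (auto simp: h_def)
  have "\<exists>x\<in>cube a l. cube (\<chi> i. a $ i + real (k i) * h) h = cell a h x"
    if k: "\<forall>i. k i < 2 ^ j" for k
  proof (rule bexI)
    let ?x = "\<chi> i. a $ i + real (k i) * h"
    show "cube ?x h = cell a h ?x"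
      using h by (simp add: cell_eq_cube)
    have "real (k i) < 2 ^ j" for i using k by (metis of_nat_less_numeral_power_cancel_iff)
    then show "?x \<in> cube a l" using h by (auto simp: cube_def)
  qed
  moreover have "\<exists>k. (\<forall>i. k i < 2 ^ j) \<and> cell a h x = cube (\<chi> i. a $ i + real (k i) * h) h"
    if x: "x \<in> cube a l" for x
  proof (intro exI conjI allI)
    let ?k = "\<lambda>i. nat \<lfloor>(x $ i - a $ i) / h\<rfloor>"
    fix i
    have *: "0 \<le> (x $ i - a $ i) / h" "(x $ i - a $ i) / h < 2 ^ j" for i
      using x h by (auto simp: cube_def field_simps)
    then have f: "0 \<le> \<lfloor>(x $ i - a $ i) / h\<rfloor>" "\<lfloor>(x $ i - a $ i) / h\<rfloor> < 2 ^ j" for i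
      by (simp_all add: floor_less_iff)
    then show "?k i < 2 ^ j" by (simp add: nat_less_iff)
    show "cell a h x = cube (\<chi> i. a $ i + real (?k i) * h) h"
      using f h by (simp add: cell_eq_cube)
  qed
  ultimately show ?thesis
    unfolding dyadic_gen_cube[OF assms] h_def[symmetric] by blast
qed

text \<open>The index at mesh \<open>2 * h\<close> is the index at mesh \<open>h\<close> divided by
  two and rounded down, so the finer index determines the coarser one.\<close>

lemma cell_double_subset:
  assumes "h > 0"
  shows "cell a h x \<subseteq> cell a (2 * h) x"
proof -
  have "\<lfloor>z / (2 * h)\<rfloor> = \<lfloor>z / h\<rfloor> div 2" for z
    using floor_divide_real_eq_div[of 2 "z / h"] by (simp add: field_simps)
  then show ?thesis by (auto simp: cell_def)
qed

lemma cell_Suc_subset: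
  assumes "l > 0"
  shows "cell a (l / 2 ^ Suc j) x \<subseteq> cell a (l / 2 ^ j) x"
  using cell_double_subset[of "l / 2 ^ Suc j"] assms by simp

lemma finite_dyadic_gen:
  assumes "Q0 \<in> cubes"
  shows "finite (dyadic_gen j Q0)"
  using card_dyadic_gen[OF assms, of j] by (metis card.infinite power_not_zero zero_neq_numeral)

lemma cell_subset_cube:
  assumes "l > 0" "x \<in> cube a l"
  shows "cell a (l / 2 ^ j) x \<subseteq> cube a l"
proof -
  have "cell a (l / 2 ^ j) x \<in> dyadic_gen j (cube a l)"
    using assms by (simp add: dyadic_gen_eq_cells)
  then show ?thesis using Union_dyadic_gen[OF cube_in_cubes[OF assms(1)], of j a] by blast
qed

section \<open>Measurability and volume of cubes and touched sets\<close>

lemma cube_borel: "cube a l \<in> sets borel"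
proof -
  have "cube a l = {x. \<forall>i\<in>UNIV. a $ i \<le> x $ i \<and> x $ i < a $ i + l}"
    by (simp add: cube_def)
  also have "\<dots> \<in> sets borel" by measurable
  finally show ?thesis .
qed

lemma cube_lmeasurable: "cube a l \<in> lmeasurable"
proof (rule bounded_set_imp_lmeasurable)
  have "cube a l \<subseteq> cbox a (\<chi> i. a $ i + l)"
    by (auto simp: cube_def mem_box_cart less_imp_le)
  then show "bounded (cube a l)" by (rule bounded_subset[OF bounded_cbox])
  show "cube a l \<in> sets lebesgue" by (intro sets_completionI_sets lborelD cube_borel)
qed

text \<open>The half-open cube lies between an open and a closed box of equal content.\<close>

lemma measure_cube:
  fixes a :: "real ^ 'n"
  assumes "l > 0"
  shows "measure lebesgue (cube a l) = l ^ CARD('n)"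
proof (rule antisym)
  let ?b = "\<chi> i. a $ i + l"
  have [simp]: "cbox a ?b \<noteq> {}" using assms by (auto simp: interval_ne_empty_cart less_imp_le)
  have c: "measure lebesgue (cbox a ?b) = l ^ CARD('n)"
    by (simp add: content_cbox_cart)
  have "cube a l \<subseteq> cbox a ?b"
    by (auto simp: cube_def mem_box_cart less_imp_le)
  then show "measure lebesgue (cube a l) \<le> l ^ CARD('n)"
    unfolding c[symmetric] by (rule measure_mono_fmeasurable) (use cube_lmeasurable in auto)
  have "box a ?b \<subseteq> cube a l"
    by (auto simp: cube_def mem_box_cart less_imp_le)
  then have "measure lebesgue (box a ?b) \<le> measure lebesgue (cube a l)"
    by (rule measure_mono_fmeasurable) (use cube_lmeasurable in auto)
  moreover have "measure lebesgue (box a ?b) = measure lebesgue (cbox a ?b)"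
    by (simp add: measure_lborel_box_eq measure_lborel_cbox_eq)
  ultimately show "l ^ CARD('n) \<le> measure lebesgue (cube a l)"
    using c by simp
qed

lemma touched_subset: "touched E a l j \<subseteq> cube a l"
  by (auto simp: touched_def)

lemma cell_subset_touched:
  assumes "l > 0" "x \<in> touched E a l j"
  shows "cell a (l / 2 ^ j) x \<subseteq> touched E a l j"
  using cell_subset_cube[of l x a j] assms by (auto simp: touched_def dest: cell_eqI)

lemma touched_lmeasurable:
  assumes "l > 0"
  shows "touched E a l j \<in> lmeasurable"
proof -
  have "touched E a l j = \<Union>{Q \<in> dyadic_gen j (cube a l). Q \<inter> E \<noteq> {}}"
    using assms cell_subset_touched[OF assms, of _ E a j]
    by (auto simp: dyadic_gen_eq_cells) (auto simp: touched_def self_mem_cell)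
  also have "\<dots> \<in> lmeasurable"
  proof (rule fmeasurable.finite_Union)
    show "finite {Q \<in> dyadic_gen j (cube a l). Q \<inter> E \<noteq> {}}"
      by (rule finite_subset[OF _ finite_dyadic_gen[OF cube_in_cubes[OF assms]]]) blast
    show "{Q \<in> dyadic_gen j (cube a l). Q \<inter> E \<noteq> {}} \<subseteq> lmeasurable"
      using assms by (auto simp: dyadic_gen_cube cube_lmeasurable)
  qed
  finally show ?thesis .
qed

lemma touched_sets:
  assumes "l > 0"
  shows "touched E a l j \<in> sets lebesgue"
  using touched_lmeasurable[OF assms] by (rule fmeasurableD)

lemma touched_Suc_subset:
  assumes "l > 0"
  shows "touched E a l (Suc j) \<subseteq> touched E a l j"
  using cell_Suc_subset[OF assms] unfolding touched_def by blast

lemma cell_top: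
  assumes "l > 0" "x \<in> cube a l"
  shows "cell a l x = cube a l"
proof -
  have "cell a l x \<in> dyadic_gen 0 (cube a l)" using assms by (auto simp: dyadic_gen_eq_cells)
  then show ?thesis using assms by (auto simp: dyadic_gen_cube)
qed

lemma touched_0:
  assumes "l > 0" "cube a l \<inter> E \<noteq> {}"
  shows "touched E a l 0 = cube a l"
  using assms by (auto simp: touched_def cell_top)

lemma infdist_le_of_touched:
  fixes a :: "real ^ 'n"
  assumes "l > 0" "x \<in> touched E a l j"
  shows "infdist x E \<le> CARD('n) * (l / 2 ^ j)"
proof -
  obtain y where "y \<in> E" "y \<in> cell a (l / 2 ^ j) x" using assms by (auto simp: touched_def)
  then show ?thesis
    using dist_le_of_mem_cell[of "l / 2 ^ j" y a x] infdist_le[of y E x] assms by simp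
qed

text \<open>A point touched in every generation is within \<open>CARD('n) * (l / 2 ^ j)\<close> of
  \<open>E\<close> for all \<open>j\<close>, hence at distance \<open>0\<close>; closedness places
  it in \<open>E\<close>.\<close>

lemma Inter_touched:
  fixes E :: "(real ^ 'n) set"
  assumes "l > 0" "closed E" "E \<noteq> {}"
  shows "(\<Inter>j. touched E a l j) \<subseteq> E"
proof
  fix x :: "real ^ 'n" assume x: "x \<in> (\<Inter>j. touched E a l j)"
  have "(\<lambda>j. real CARD('n) * (l / 2 ^ j)) \<longlonglongrightarrow> real CARD('n) * 0"
    by (intro tendsto_intros LIMSEQ_divide_realpow_zero) auto
  then have "infdist x E \<le> 0"
    using infdist_le_of_touched[OF assms(1), of x E a] x
    by (intro LIMSEQ_le_const) auto
  then have "infdist x E = 0" using infdist_nonneg[of x E] by simp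
  then show "x \<in> E" using in_closed_iff_infdist_zero[OF assms(2,3)] by simp
qed

section \<open>The relative volume of the touched sets, and dyadic parents\<close>

definition touched_frac :: "(real ^ 'n) set \<Rightarrow> real ^ 'n \<Rightarrow> real \<Rightarrow> nat \<Rightarrow> real" where
  "touched_frac E a l j = measure lebesgue (touched E a l j) / measure lebesgue (cube a l)"

lemma touched_frac_0:
  assumes "l > 0" "cube a l \<inter> E \<noteq> {}"
  shows "touched_frac E a l 0 = 1"
  using assms by (simp add: touched_frac_def touched_0 measure_cube)

lemma touched_frac_nonneg: "touched_frac E a l j \<ge> 0"
  by (simp add: touched_frac_def)

lemma touched_frac_le_1:
  assumes "l > 0"
  shows "touched_frac E a l j \<le> 1"
proof -
  have "measure lebesgue (touched E a l j) \<le> measure lebesgue (cube a l)"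
    by (rule measure_mono_fmeasurable[OF touched_subset touched_sets[OF assms] cube_lmeasurable])
  then show ?thesis
    using assms by (simp add: touched_frac_def measure_cube)
qed

text \<open>Continuity of the measure from above along the decreasing touched sets, whose
  intersection is contained in the null set \<open>E\<close>.\<close>

lemma touched_frac_tendsto:
  fixes E :: "(real ^ 'n) set"
  assumes "l > 0" "closed E" "E \<noteq> {}" "emeasure lebesgue E = 0"
  shows "touched_frac E a l \<longlonglongrightarrow> 0"
proof -
  have m: "touched E a l j \<in> sets lebesgue" for j using touched_lmeasurable[OF assms(1)] by auto
  have "decseq (touched E a l)"
    by (rule decseq_SucI) (rule touched_Suc_subset[OF assms(1)])
  then have "(\<lambda>j. measure lebesgue (touched E a l j)) \<longlonglongrightarrow> measure lebesgue (\<Inter>j. touched E a l j)"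
    using m fmeasurableD2[OF touched_lmeasurable[OF assms(1)]]
    by (intro Lim_measure_decseq) (auto simp del: emeasure_completion)
  moreover have "(\<Inter>j. touched E a l j) \<in> null_sets lebesgue"
  proof (rule null_sets_subset)
    have "E \<in> sets lebesgue" using borel_closed[OF assms(2)] by simp
    then show "E \<in> null_sets lebesgue" using assms(4) by (rule null_setsI[rotated])
    show "(\<Inter>j. touched E a l j) \<in> sets lebesgue" using m by (intro sets.countable_INT) auto
    show "(\<Inter>j. touched E a l j) \<subseteq> E" by (rule Inter_touched[OF assms(1-3)])
  qed
  then have "measure lebesgue (\<Inter>j. touched E a l j) = 0"
    by (rule measure_eq_0_null_sets)
  ultimately have "(\<lambda>j. measure lebesgue (touched E a l j)) \<longlonglongrightarrow> 0" by metis
  from tendsto_mult_left_zero[OF this, of "inverse (measure lebesgue (cube a l))"] show ?thesis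
    by (simp only: touched_frac_def[abs_def] divide_inverse)
qed

text \<open>The definite description ranges over all generations: the side length of the child fixes
  the generation, and the common point \<open>x\<close> then fixes the parent.\<close>

lemma dyadic_parent_cell:
  assumes "l > 0" "x \<in> cube a l"
  shows "dyadic_parent (cube a l) (cell a (l / 2 ^ Suc j) x) = cell a (l / 2 ^ j) x"
  unfolding dyadic_parent_def
proof (rule the_equality)
  have Q0: "cube a l \<in> cubes" using assms by (simp add: cube_in_cubes)
  show "\<exists>i. cell a (l / 2 ^ Suc j) x \<in> dyadic_gen (Suc i) (cube a l) \<and>
    cell a (l / 2 ^ j) x \<in> dyadic_gen i (cube a l) \<and> cell a (l / 2 ^ Suc j) x \<subseteq> cell a (l / 2 ^ j) x"
    using assms cell_Suc_subset[OF assms(1)] by (intro exI[of _ j]) (simp add: dyadic_gen_eq_cells)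
  fix P
  assume "\<exists>i. cell a (l / 2 ^ Suc j) x \<in> dyadic_gen (Suc i) (cube a l) \<and>
    P \<in> dyadic_gen i (cube a l) \<and> cell a (l / 2 ^ Suc j) x \<subseteq> P"
  then obtain i where i: "cell a (l / 2 ^ Suc j) x \<in> dyadic_gen (Suc i) (cube a l)"
    "P \<in> dyadic_gen i (cube a l)" "cell a (l / 2 ^ Suc j) x \<subseteq> P" by blast
  have "cell a (l / 2 ^ Suc j) x \<in> dyadic_gen (Suc j) (cube a l)"
    using assms by (simp add: dyadic_gen_eq_cells)
  then have "side_length (cube a l) / 2 ^ Suc i = side_length (cube a l) / 2 ^ Suc j"
    using side_length_dyadic_gen(2)[OF Q0] i(1) by metis
  then have "i = j" using assms(1) by (simp add: side_length_cube field_simps)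
  moreover have "x \<in> P" using i(3) self_mem_cell by blast
  ultimately show "P = cell a (l / 2 ^ j) x"
    using i(2) assms(1) by (auto simp: dyadic_gen_eq_cells dest: cell_eqI)
qed

subsection \<open>The scales \<open>L_large\<close> and \<open>S_small\<close>\<close>

text \<open>A point leaves the touched sets after index \<open>j\<close> exactly when its cell of
  generation \<open>Suc j\<close> misses \<open>E\<close> while the parent meets it. The index is
  that of the parent, so these cubes have side \<open>l / 2 ^ Suc j\<close>.\<close>

definition avoiding_gen :: "(real ^ 'n) set \<Rightarrow> real ^ 'n \<Rightarrow> real \<Rightarrow> nat \<Rightarrow> (real ^ 'n) set set" where
  "avoiding_gen E a l j = cell a (l / 2 ^ Suc j) ` (touched E a l j - touched E a l (Suc j))"

lemma dyadic_avoiding_eq: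
  assumes "l > 0" "closed E"
  shows "dyadic_avoiding E (cube a l) = (\<Union>j. avoiding_gen E a l j)"
proof (intro equalityI subsetI)
  have [simp]: "closure E = E" using assms by simp
  have Q0: "cube a l \<in> cubes" using assms by (simp add: cube_in_cubes)
  fix Q
  {
    assume Q: "Q \<in> dyadic_avoiding E (cube a l)"
    then obtain i x where i: "Q = cell a (l / 2 ^ i) x" "x \<in> cube a l"
      using assms by (auto simp: dyadic_avoiding_def dyadic_def dyadic_gen_eq_cells)
    \<comment> \<open>Generation \<open>0\<close> contains only the initial cube, which the
      definition of \<open>dyadic_avoiding\<close> excludes.\<close>
    have "i \<noteq> 0" using Q i assms by (auto simp: dyadic_avoiding_def cell_top)
    then obtain j where "i = Suc j" using not0_implies_Suc by blast
    then show "Q \<in> (\<Union>j. avoiding_gen E a l j)"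
      using Q i dyadic_parent_cell[OF assms(1) i(2), of j]
      by (auto simp: dyadic_avoiding_def avoiding_gen_def touched_def intro!: exI[of _ j])
  next
    assume "Q \<in> (\<Union>j. avoiding_gen E a l j)"
    then obtain j x where x: "Q = cell a (l / 2 ^ Suc j) x" "x \<in> cube a l"
      "cell a (l / 2 ^ Suc j) x \<inter> E = {}" "cell a (l / 2 ^ j) x \<inter> E \<noteq> {}"
      by (auto simp: avoiding_gen_def touched_def)
    have Qg: "Q \<in> dyadic_gen (Suc j) (cube a l)" using x assms by (simp add: dyadic_gen_eq_cells)
    then have "side_length Q \<noteq> l"
      using side_length_dyadic_gen(2)[OF Q0 Qg] assms(1) less_imp_neq[OF power_gt1[of "2::real" j]]
      by (simp add: side_length_cube[OF assms(1)] divide_eq_eq del: power_Suc)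
    then have "Q \<noteq> cube a l" using side_length_cube[OF assms(1)] by metis
    then show "Q \<in> dyadic_avoiding E (cube a l)"
      using Qg x dyadic_parent_cell[OF assms(1) x(2), of j]
      by (auto simp: dyadic_avoiding_def dyadic_def)
  }
qed

lemma avoiding_gen_subset:
  assumes "l > 0"
  shows "avoiding_gen E a l j \<subseteq> dyadic_gen (Suc j) (cube a l)"
  using assms by (auto simp: dyadic_gen_eq_cells avoiding_gen_def touched_def)

lemma side_length_avoiding_gen:
  assumes "l > 0" "Q \<in> avoiding_gen E a l j"
  shows "side_length Q = l / 2 ^ Suc j"
proof -
  have "Q \<in> dyadic_gen (Suc j) (cube a l)"
    using avoiding_gen_subset[OF assms(1)] assms(2) by blast
  then show ?thesis
    using side_length_dyadic_gen(2)[OF cube_in_cubes[OF assms(1)]] side_length_cube[OF assms(1)] by metis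
qed

lemma Union_avoiding_gen:
  assumes "l > 0"
  shows "\<Union>(avoiding_gen E a l j) = touched E a l j - touched E a l (Suc j)"
proof -
  have "cell a (l / 2 ^ Suc j) x \<subseteq> touched E a l j - touched E a l (Suc j)"
    if "x \<in> touched E a l j - touched E a l (Suc j)" for x
  proof
    fix y assume y: "y \<in> cell a (l / 2 ^ Suc j) x"
    then have "y \<in> touched E a l j"
      using cell_Suc_subset[OF assms] cell_subset_touched[OF assms] that by blast
    moreover have "y \<notin> touched E a l (Suc j)"
      using that cell_eqI[OF y] by (auto simp: touched_def)
    ultimately show "y \<in> touched E a l j - touched E a l (Suc j)" by blast
  qed
  then show ?thesis using self_mem_cell unfolding avoiding_gen_def by fast
qed

lemma sum_avoiding_gen:
  assumes "l > 0"
  shows "(\<Sum>Q\<in>avoiding_gen E a l j. measure lebesgue Q / measure lebesgue (cube a l)) =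
    touched_frac E a l j - touched_frac E a l (Suc j)"
proof -
  have Q0: "cube a l \<in> cubes" using assms by (simp add: cube_in_cubes)
  have "(\<Sum>Q\<in>avoiding_gen E a l j. measure lebesgue Q) = measure lebesgue (\<Union>(avoiding_gen E a l j))"
  proof (rule measure_Union'[symmetric])
    show "finite (avoiding_gen E a l j)"
      by (rule finite_subset[OF avoiding_gen_subset[OF assms] finite_dyadic_gen[OF Q0]])
    show "pairwise disjnt (avoiding_gen E a l j)"
      using disjoint_dyadic_gen[OF Q0, of "Suc j"] avoiding_gen_subset[OF assms, of E a j]
      unfolding disjoint_def pairwise_def disjnt_def by blast
    show "Q \<in> lmeasurable" if "Q \<in> avoiding_gen E a l j" for Q
      using that assms by (auto simp: avoiding_gen_def cell_eq_cube cube_lmeasurable)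
  qed
  also have "\<dots> = measure lebesgue (touched E a l j) - measure lebesgue (touched E a l (Suc j))"
    unfolding Union_avoiding_gen[OF assms]
    using touched_lmeasurable[OF assms]
    by (intro measurable_measure_Diff touched_Suc_subset assms) auto
  finally show ?thesis
    by (simp add: touched_frac_def diff_divide_distrib flip: sum_divide_distrib)
qed

lemma finite_avoiding_gen:
  assumes "l > 0"
  shows "finite (avoiding_gen E a l j)"
  by (rule finite_subset[OF avoiding_gen_subset[OF assms] finite_dyadic_gen[OF cube_in_cubes[OF assms]]])

text \<open>Distinct indices give distinct side lengths, so the families are disjoint, and the
  volumes of the layers telescope from \<open>touched_frac E a l 0 = 1\<close>.\<close>

lemma sum_UN_avoiding_gen:
  assumes "l > 0" "cube a l \<inter> E \<noteq> {}"
  shows "(\<Sum>Q\<in>(\<Union>i<j. avoiding_gen E a l i). measure lebesgue Q / measure lebesgue (cube a l)) =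
    1 - touched_frac E a l j"
proof -
  have "avoiding_gen E a l i \<inter> avoiding_gen E a l i' = {}" if "i \<noteq> i'" for i i'
  proof (rule ccontr)
    assume "avoiding_gen E a l i \<inter> avoiding_gen E a l i' \<noteq> {}"
    then have "l / 2 ^ Suc i = l / 2 ^ Suc i'"
      using side_length_avoiding_gen[OF assms(1)] by (metis Int_emptyI)
    then show False using that assms(1) by (simp add: field_simps)
  qed
  then have "(\<Sum>Q\<in>(\<Union>i<j. avoiding_gen E a l i). measure lebesgue Q / measure lebesgue (cube a l)) =
    (\<Sum>i<j. \<Sum>Q\<in>avoiding_gen E a l i. measure lebesgue Q / measure lebesgue (cube a l))"
    by (intro sum.UNION_disjoint) (auto simp: finite_avoiding_gen assms)
  also have "\<dots> = touched_frac E a l 0 - touched_frac E a l j"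
    unfolding sum_avoiding_gen[OF assms(1)] by (rule sum_lessThan_telescope')
  finally show ?thesis by (simp add: touched_frac_0 assms)
qed

text \<open>Any finite subfamily uses finitely many generations, so its sum is at most
  \<open>1\<close>; the sums over the first \<open>j\<close> indices tend to \<open>1\<close>
  because \<open>E\<close> is null. The total is needed for the infinite sums in
  \<open>S_small\<close>.\<close>

lemma has_sum_dyadic_avoiding:
  assumes "l > 0" "closed E" "emeasure lebesgue E = 0" "cube a l \<inter> E \<noteq> {}"
  shows "((\<lambda>Q. measure lebesgue Q / measure lebesgue (cube a l)) has_sum 1) (dyadic_avoiding E (cube a l))"
proof -
  let ?f = "\<lambda>Q. measure lebesgue Q / measure lebesgue (cube a l)"
  let ?D = "dyadic_avoiding E (cube a l)" and ?U = "\<lambda>j. \<Union>i<j. avoiding_gen E a l i"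
  have finU: "finite (?U j)" for j by (simp add: finite_avoiding_gen assms)
  have le1: "sum ?f F \<le> 1" if F: "finite F" "F \<subseteq> ?D" for F
  proof -
    have "\<exists>j. F \<subseteq> ?U j"
      using F
    proof induction
      case (insert Q F)
      then obtain j i where "F \<subseteq> ?U j" "Q \<in> avoiding_gen E a l i"
        using dyadic_avoiding_eq[OF assms(1,2), of a] by auto
      then have "insert Q F \<subseteq> ?U (max j (Suc i))" by (fastforce simp: less_max_iff_disj)
      then show ?case by blast
    qed simp
    then obtain j where "F \<subseteq> ?U j" by blast
    then have "sum ?f F \<le> sum ?f (?U j)" by (intro sum_mono2 finU) auto
    also have "\<dots> \<le> 1" using touched_frac_nonneg[of E a l j] by (simp add: sum_UN_avoiding_gen assms)
    finally show ?thesis .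
  qed
  have summ: "?f summable_on ?D"
    by (rule nonneg_bdd_above_summable_on) (auto intro!: bdd_aboveI2[where M = 1] le1)
  have "infsum ?f ?D \<le> 1" by (rule infsum_le_finite_sums[OF summ le1])
  moreover have "infsum ?f ?D \<ge> 1"
  proof (rule LIMSEQ_le_const2)
    have "(\<lambda>j. 1 - touched_frac E a l j) \<longlonglongrightarrow> 1 - 0"
      using assms by (intro tendsto_intros touched_frac_tendsto) auto
    then show "(\<lambda>j. 1 - touched_frac E a l j) \<longlonglongrightarrow> 1" by simp
    have "1 - touched_frac E a l j \<le> infsum ?f ?D" for j
      unfolding sum_UN_avoiding_gen[OF assms(1,4), symmetric]
      using dyadic_avoiding_eq[OF assms(1,2), of a]
      by (intro finite_sum_le_infsum summ finU) auto
    then show "\<exists>N. \<forall>j\<ge>N. 1 - touched_frac E a l j \<le> infsum ?f ?D" by blast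
  qed
  ultimately show ?thesis using has_sum_infsum[OF summ] by simp
qed

text \<open>In fact \<open>L_large\<close> equals \<open>l / 2 ^ m\<close> for the least
  \<open>m\<close> with \<open>t \<le> 1 - touched_frac E a l m\<close>, since the cubes of side at
  least \<open>l / 2 ^ m\<close> are those of index below \<open>m\<close>.\<close>

lemma L_large_ge:
  assumes "l > 0" "closed E" "emeasure lebesgue E = 0" "cube a l \<inter> E \<noteq> {}"
    and "0 < t" "t \<le> 1 - touched_frac E a l j"
  shows "l / 2 ^ j \<le> L_large E (cube a l) t"
proof -
  let ?f = "\<lambda>Q. measure lebesgue Q / measure lebesgue (cube a l)"
  let ?D = "dyadic_avoiding E (cube a l)" and ?U = "\<lambda>j. \<Union>i<j. avoiding_gen E a l i"
  define m where "m = (LEAST j. t \<le> 1 - touched_frac E a l j)"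
  have m: "t \<le> 1 - touched_frac E a l m" "m \<le> j"
    unfolding m_def using assms(6)
    by (rule LeastI[where P = "\<lambda>j. t \<le> 1 - touched_frac E a l j"],
        rule Least_le[where P = "\<lambda>j. t \<le> 1 - touched_frac E a l j"])
  \<comment> \<open>At index \<open>0\<close> nothing has been removed from the cube, and
    \<open>t\<close> is positive.\<close>
  have "m \<noteq> 0" using m(1) assms(5) touched_frac_0[OF assms(1,4)] by (cases "m = 0") auto
  then obtain m' where m': "m = Suc m'" using not0_implies_Suc by blast
  have less: "1 - touched_frac E a l m' < t"
    using not_less_Least[of m' "\<lambda>j. t \<le> 1 - touched_frac E a l j"] m' by (simp add: m_def)
  have finU: "finite (?U j)" for j by (simp add: finite_avoiding_gen assms)
  have sub: "{Q \<in> ?D. L \<le> side_length Q} \<subseteq> ?U j" if "l / 2 ^ Suc j < L" for L j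
  proof
    fix Q assume Q: "Q \<in> {Q \<in> ?D. L \<le> side_length Q}"
    then obtain i where i: "Q \<in> avoiding_gen E a l i"
      using dyadic_avoiding_eq[OF assms(1,2), of a] by auto
    then have "l / 2 ^ Suc j < l / 2 ^ Suc i"
      using that Q side_length_avoiding_gen[OF assms(1)] by fastforce
    then have "i < j" using assms(1) by (simp add: field_simps)
    then show "Q \<in> ?U j" using i by blast
  qed
  have "L_large E (cube a l) t = l / 2 ^ m"
    unfolding L_large_def
  proof (rule Greatest_equality)
    have "?U m \<subseteq> {Q \<in> ?D. l / 2 ^ m \<le> side_length Q}"
    proof
      fix Q assume "Q \<in> ?U m"
      then obtain i where "i < m" and i: "Q \<in> avoiding_gen E a l i" by blast
      moreover from \<open>i < m\<close> have "(2::real) ^ Suc i \<le> 2 ^ m" by (intro power_increasing) auto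
      then have "l / 2 ^ m \<le> l / 2 ^ Suc i" using assms(1) by (intro divide_left_mono) auto
      ultimately show "Q \<in> {Q \<in> ?D. l / 2 ^ m \<le> side_length Q}"
        using dyadic_avoiding_eq[OF assms(1,2), of a] side_length_avoiding_gen[OF assms(1) i] by auto
    qed
    moreover have "l / 2 ^ Suc m < l / 2 ^ m" using assms(1) by (simp add: field_simps)
    ultimately have "{Q \<in> ?D. l / 2 ^ m \<le> side_length Q} = ?U m" using sub by blast
    then show "0 \<le> l / 2 ^ m \<and> t \<le> infsum ?f {Q \<in> ?D. l / 2 ^ m \<le> side_length Q}"
      using m(1) assms(1) by (simp only: infsum_finite[OF finU] sum_UN_avoiding_gen[OF assms(1,4)]) simp
    fix L assume L: "0 \<le> L \<and> t \<le> infsum ?f {Q \<in> ?D. L \<le> side_length Q}"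
    show "L \<le> l / 2 ^ m"
    proof (rule ccontr)
      assume "\<not> L \<le> l / 2 ^ m"
      \<comment> \<open>A threshold above \<open>l / 2 ^ Suc m'\<close> keeps only indices below
        \<open>m'\<close>, whose total is less than \<open>t\<close> by minimality of
        \<open>m\<close>.\<close>
      then have s: "{Q \<in> ?D. L \<le> side_length Q} \<subseteq> ?U m'" by (intro sub) (simp add: m')
      have "infsum ?f {Q \<in> ?D. L \<le> side_length Q} = sum ?f {Q \<in> ?D. L \<le> side_length Q}"
        by (rule infsum_finite[OF finite_subset[OF s finU]])
      also have "\<dots> \<le> sum ?f (?U m')" by (rule sum_mono2[OF finU s]) auto
      finally show False using less L by (simp add: sum_UN_avoiding_gen[OF assms(1,4)])
    qed
  qed
  moreover have "l / 2 ^ j \<le> l / 2 ^ m"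
    using m(2) assms(1) by (intro divide_left_mono power_increasing) auto
  ultimately show ?thesis by simp
qed

text \<open>In fact \<open>S_small\<close> equals \<open>l / 2 ^ Suc m\<close> for the greatest
  \<open>m\<close> with \<open>t \<le> touched_frac E a l m\<close>: the cubes of side at most
  \<open>l / 2 ^ Suc j\<close> are those of index at least \<open>j\<close>, with total
  \<open>touched_frac E a l j\<close>.\<close>

lemma S_small_le:
  assumes "l > 0" "closed E" "emeasure lebesgue E = 0" "cube a l \<inter> E \<noteq> {}"
    and "0 < t" "t \<le> touched_frac E a l j"
  shows "S_small E (cube a l) t \<le> l / 2 ^ Suc j"
proof -
  let ?f = "\<lambda>Q. measure lebesgue Q / measure lebesgue (cube a l)"
  let ?D = "dyadic_avoiding E (cube a l)" and ?U = "\<lambda>j. \<Union>i<j. avoiding_gen E a l i"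
  have "E \<noteq> {}" using assms by auto
  from order_tendstoD(2)[OF touched_frac_tendsto[OF assms(1,2) this assms(3)] assms(5)]
  obtain N where N: "\<And>i. i \<ge> N \<Longrightarrow> touched_frac E a l i < t"
    unfolding eventually_sequentially by blast
  \<comment> \<open>The maximum exists because \<open>touched_frac\<close> tends to \<open>0\<close>
    and so falls below \<open>t\<close> for good.\<close>
  define m where "m = (GREATEST j. t \<le> touched_frac E a l j)"
  have bnd: "\<forall>i. t \<le> touched_frac E a l i \<longrightarrow> i \<le> N" using N by (meson linorder_not_le nat_le_linear)
  have m: "t \<le> touched_frac E a l m" "j \<le> m"
    unfolding m_def
    using GreatestI_nat[where P = "\<lambda>j. t \<le> touched_frac E a l j", OF assms(6)] bnd
      Greatest_le_nat[where P = "\<lambda>j. t \<le> touched_frac E a l j", OF assms(6)] by blast+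
  have less: "touched_frac E a l (Suc m) < t"
    using Greatest_le_nat[of "\<lambda>j. t \<le> touched_frac E a l j" "Suc m" N] bnd
    by (fastforce simp: m_def)
  have finU: "finite (?U j)" for j by (simp add: finite_avoiding_gen assms)
  have UD: "?U j \<subseteq> ?D" for j using dyadic_avoiding_eq[OF assms(1,2), of a] by blast
  have side: "{Q \<in> ?D. side_length Q \<le> l / 2 ^ Suc j} = ?D - ?U j" for j
  proof -
    have "side_length Q \<le> l / 2 ^ Suc j \<longleftrightarrow> Q \<notin> ?U j" if Q: "Q \<in> ?D" for Q
    proof -
      obtain i where i: "Q \<in> avoiding_gen E a l i"
        using Q unfolding dyadic_avoiding_eq[OF assms(1,2)] by blast
      have "i = i'" if "Q \<in> avoiding_gen E a l i'" for i'
        using side_length_avoiding_gen[OF assms(1) i] side_length_avoiding_gen[OF assms(1) that] assms(1)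
        by simp
      then have "Q \<in> ?U j \<longleftrightarrow> i < j" using i by blast
      moreover have "l / 2 ^ Suc i \<le> l / 2 ^ Suc j \<longleftrightarrow> j \<le> i"
        using assms(1) by (simp add: field_simps)
      ultimately show ?thesis using side_length_avoiding_gen[OF assms(1) i] by auto
    qed
    then show ?thesis by blast
  qed
  note hs = has_sum_dyadic_avoiding[OF assms(1-4)]
  \<comment> \<open>Removing the finitely many larger cubes from the total \<open>1\<close>
    evaluates the infinite tail as \<open>1 - (1 - touched_frac E a l j)\<close>.\<close>
  have hsj: "(?f has_sum touched_frac E a l j) {Q \<in> ?D. side_length Q \<le> l / 2 ^ Suc j}" for j
    unfolding side
    using has_sum_Diff[OF hs has_sum_finite[OF finU] UD, of j]
    by (simp add: sum_UN_avoiding_gen[OF assms(1,4)])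
  have "S_small E (cube a l) t = l / 2 ^ Suc m"
    unfolding S_small_def
  proof (rule Least_equality)
    show "0 \<le> l / 2 ^ Suc m \<and> t \<le> infsum ?f {Q \<in> ?D. side_length Q \<le> l / 2 ^ Suc m}"
      using m(1) assms(1) by (simp only: infsumI[OF hsj]) simp
    fix L assume L: "0 \<le> L \<and> t \<le> infsum ?f {Q \<in> ?D. side_length Q \<le> L}"
    show "l / 2 ^ Suc m \<le> L"
    proof (rule ccontr)
      assume nL: "\<not> l / 2 ^ Suc m \<le> L"
      \<comment> \<open>Sides are dyadic, so a threshold below \<open>l / 2 ^ Suc m\<close> admits
        nothing larger than the next scale, where the total is already below
        \<open>t\<close>.\<close>
      have s: "{Q \<in> ?D. side_length Q \<le> L} \<subseteq> {Q \<in> ?D. side_length Q \<le> l / 2 ^ Suc (Suc m)}"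
      proof (intro subsetI CollectI conjI)
        fix Q assume Q: "Q \<in> {Q \<in> ?D. side_length Q \<le> L}"
        then show "Q \<in> ?D" by simp
        obtain i where i: "Q \<in> avoiding_gen E a l i"
          using Q dyadic_avoiding_eq[OF assms(1,2), of a] by auto
        then have "l / 2 ^ Suc i < l / 2 ^ Suc m"
          using nL Q side_length_avoiding_gen[OF assms(1)] by fastforce
        then have "Suc m \<le> i" using assms(1) by (simp add: field_simps)
        then have "l / 2 ^ Suc i \<le> l / 2 ^ Suc (Suc m)"
          using assms(1) by (intro divide_left_mono power_increasing) auto
        then show "side_length Q \<le> l / 2 ^ Suc (Suc m)"
          using side_length_avoiding_gen[OF assms(1) i] by simp
      qed
      have "infsum ?f {Q \<in> ?D. side_length Q \<le> L} \<le> infsum ?f {Q \<in> ?D. side_length Q \<le> l / 2 ^ Suc (Suc m)}"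
        using s has_sum_imp_summable[OF hsj]
        by (intro infsum_mono_neutral) (auto intro: summable_on_subset_banach[OF has_sum_imp_summable[OF hs]])
      then show False using less L infsumI[OF hsj, of "Suc m"] by simp
    qed
  qed
  moreover have "l / 2 ^ Suc m \<le> l / 2 ^ Suc j"
    using m(2) assms(1) by (intro divide_left_mono power_increasing) auto
  ultimately show ?thesis by simp
qed

section \<open>Decay of the touched fraction on either side of the critical generation\<close>

lemma le_powr_of_scale_le:
  fixes l \<sigma> C t x y :: real
  assumes "l > 0" "\<sigma> > 0" "C > 0" "t > 0"
    and "l * 2 powr x \<le> C / t powr \<sigma> * (l * 2 powr y)"
  shows "t \<le> C powr (1 / \<sigma>) * 2 powr ((y - x) * (1 / \<sigma>))"
proof -
  have "t powr \<sigma> \<le> C * 2 powr (y - x)"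
    using assms by (simp add: powr_diff field_simps)
  then have "(t powr \<sigma>) powr (1 / \<sigma>) \<le> (C * 2 powr (y - x)) powr (1 / \<sigma>)"
    using assms by (intro powr_mono2) auto
  then show ?thesis
    using assms by (simp add: powr_powr powr_mult)
qed

text \<open>The level \<open>t\<close> is chosen so that one scale is pinned at the critical
  generation \<open>J\<close> and the other at \<open>j\<close>. The hypothesis bounds the ratio of
  the scales by a negative power of \<open>t\<close>, which turns into an upper bound for
  \<open>t\<close>.\<close>

lemma touched_frac_decay:
  fixes E :: "(real ^ 'n) set" and \<sigma> C l :: real
  assumes "l > 0" "closed E" "emeasure lebesgue E = 0" "cube a l \<inter> E \<noteq> {}" "\<sigma> > 0" "C > 0"
    and LS: "\<And>t. 0 < t \<Longrightarrow> t < 1 \<Longrightarrow> L_large E (cube a l) t \<le> C / t powr \<sigma> * S_small E (cube a l) t"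
  obtains J where "J \<ge> 1"
    and "\<And>j. touched_frac E a l j \<le> 2 * C powr (1 / \<sigma>) * 2 powr ((real J - real j) * (1 / \<sigma>))"
    and "\<And>j. 1 - touched_frac E a l j \<le> 2 * C powr (1 / \<sigma>) * 2 powr ((real j - real J) * (1 / \<sigma>))"
proof -
  let ?f = "touched_frac E a l"
  have "E \<noteq> {}" using assms(4) by auto
  from order_tendstoD(2)[OF touched_frac_tendsto[OF assms(1,2) this assms(3), of a], of "1/2"]
  obtain N where N: "?f N < 1/2"
    unfolding eventually_sequentially by auto
  define J where "J = (LEAST j. ?f j < 1/2)"
  have J: "?f J < 1/2" unfolding J_def by (rule LeastI[where P = "\<lambda>j. ?f j < 1/2", OF N])
  have "J \<noteq> 0" using J touched_frac_0[OF assms(1,4)] by (cases "J = 0") auto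
  then obtain J' where J': "J = Suc J'" using not0_implies_Suc by blast
  have half: "?f J' \<ge> 1/2"
    using not_less_Least[of J' "\<lambda>j. ?f j < 1/2"] J' by (simp add: J_def)
  have scale: "l / 2 ^ j = l * 2 powr (- real j)" for j
    by (simp add: powr_minus powr_realpow divide_inverse)
  show ?thesis
  proof (rule that[of J])
    show "J \<ge> 1" using J' by simp
    fix j
    show "?f j \<le> 2 * C powr (1 / \<sigma>) * 2 powr ((real J - real j) * (1 / \<sigma>))"
    proof (cases "?f j = 0")
      case False
      \<comment> \<open>The bound by \<open>?f j\<close> controls \<open>S_small\<close> at scale
        \<open>j\<close>, the bound by \<open>1/2\<close> controls \<open>L_large\<close> at scale
        \<open>J\<close>; truncating at \<open>1/2\<close> costs only the factor \<open>2\<close>,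
        because \<open>?f j \<le> 1\<close>.\<close>
      define t where "t = min (?f j) (1/2)"
      have t: "0 < t" "t < 1" "t \<le> ?f j" "t \<le> 1 - ?f J" "?f j \<le> 2 * t"
        using False J touched_frac_nonneg[of E a l j] touched_frac_le_1[OF assms(1), of E a j] by (auto simp: t_def min_def)
      have "l / 2 ^ J \<le> L_large E (cube a l) t"
        by (rule L_large_ge[OF assms(1-4) t(1,4)])
      also have "\<dots> \<le> C / t powr \<sigma> * S_small E (cube a l) t" by (rule LS[OF t(1,2)])
      also have "\<dots> \<le> C / t powr \<sigma> * (l / 2 ^ Suc j)"
        using S_small_le[OF assms(1-4) t(1,3)] assms(6) by (intro mult_left_mono) auto
      also have "\<dots> \<le> C / t powr \<sigma> * (l / 2 ^ j)"
        using assms(1,6) by (intro mult_left_mono divide_left_mono power_increasing) auto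
      finally have "t \<le> C powr (1 / \<sigma>) * 2 powr ((- real j - - real J) * (1 / \<sigma>))"
        unfolding scale by (rule le_powr_of_scale_le[OF assms(1,5,6) t(1)])
      then show ?thesis using t(5) by (simp add: algebra_simps)
    qed (use assms in auto)
    show "1 - ?f j \<le> 2 * C powr (1 / \<sigma>) * 2 powr ((real j - real J) * (1 / \<sigma>))"
    proof (cases "?f j = 1")
      case False
      \<comment> \<open>The roles are exchanged: \<open>L_large\<close> is controlled at
        \<open>j\<close>, and \<open>S_small\<close> through \<open>J'\<close>, the last generation
        with fraction at least \<open>1/2\<close>; its scale \<open>l / 2 ^ Suc J'\<close> is
        \<open>l / 2 ^ J\<close>.\<close>
      define t where "t = min (1 - ?f j) (1/2)"
      have t: "0 < t" "t < 1" "t \<le> 1 - ?f j" "t \<le> ?f J'" "1 - ?f j \<le> 2 * t"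
        using False half touched_frac_nonneg[of E a l j] touched_frac_le_1[OF assms(1), of E a j] by (auto simp: t_def min_def)
      have "l / 2 ^ j \<le> L_large E (cube a l) t"
        by (rule L_large_ge[OF assms(1-4) t(1,3)])
      also have "\<dots> \<le> C / t powr \<sigma> * S_small E (cube a l) t" by (rule LS[OF t(1,2)])
      also have "\<dots> \<le> C / t powr \<sigma> * (l / 2 ^ J)"
        using S_small_le[OF assms(1-4) t(1,4)] assms(6) unfolding J' by (intro mult_left_mono) auto
      finally have "t \<le> C powr (1 / \<sigma>) * 2 powr ((- real J - - real j) * (1 / \<sigma>))"
        unfolding scale by (rule le_powr_of_scale_le[OF assms(1,5,6) t(1)])
      then show ?thesis using t(5) by (simp add: algebra_simps)
    qed (use assms in auto)
  qed
qed

subsection \<open>Averages of powers of the distance\<close>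

lemma sum_power_le_inverse:
  fixes q :: real
  assumes "0 \<le> q" "q < 1"
  shows "(\<Sum>i<n. q ^ i) \<le> 1 / (1 - q)"
  using assms sum_le_suminf[of "\<lambda>i. q ^ i" "{..<n}"] by (simp add: summable_geometric suminf_geometric)

text \<open>Split the cube into \<open>touched E a l J\<close> and the layers left after each index
  \<open>j < J\<close>. A layer has distance \<open>O(l / 2 ^ j)\<close> and small volume by
  \<open>decay\<close>; since \<open>\<beta> < \<tau>\<close>, the contributions form a geometric
  series of ratio \<open>2 powr (\<beta> - \<tau>)\<close>.\<close>

lemma nn_integral_infdist_powr_le:
  fixes E :: "(real ^ 'n) set" and a :: "real ^ 'n" and l \<beta> \<tau> D :: real
  assumes "l > 0" "cube a l \<inter> E \<noteq> {}" "0 < \<beta>" "\<beta> < \<tau>" "D \<ge> 0"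
    and decay: "\<And>j. 1 - touched_frac E a l j \<le> D * 2 powr ((real j - real J) * \<tau>)"
  shows "(\<integral>\<^sup>+x\<in>cube a l. ennreal (infdist x E powr \<beta>) \<partial>lebesgue) \<le>
    ennreal ((CARD('n) powr \<beta> + (2 * real CARD('n)) powr \<beta> * D / (1 - 2 powr (\<beta> - \<tau>)))
      * (l / 2 ^ J) powr \<beta> * measure lebesgue (cube a l))"
proof -
  let ?Q = "cube a l" and ?n = "real CARD('n)"
  \<comment> \<open>Here \<open>A j\<close> is the complement of the touched set, unlike the
    \<open>A j\<close> of the overview.\<close>
  define A where "A j = ?Q - touched E a l j" for j
  define c where "c j = (?n * (l / 2 ^ j)) powr \<beta>" for j
  define q where "q = 2 powr (\<beta> - \<tau>)"
  define \<rho> where "\<rho> = l / 2 ^ J"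
  have q: "0 < q" "q < 1" using assms by (auto simp: q_def powr_less_one)
  have pos: "\<rho> > 0" "?n > 0" using assms by (auto simp: \<rho>_def)
  have meas: "A j \<in> sets lebesgue" "?Q \<in> sets lebesgue" for j
    using touched_sets[OF assms(1), of E a] fmeasurableD[OF cube_lmeasurable[of a l]] by (auto simp: A_def)
  have A: "measure lebesgue (A j) \<le> D * 2 powr ((real j - real J) * \<tau>) * measure lebesgue ?Q" for j
  proof -
    have "measure lebesgue (A j) = measure lebesgue ?Q - measure lebesgue (touched E a l j)"
      unfolding A_def by (intro measurable_measure_Diff cube_lmeasurable touched_sets touched_subset assms)
    also have "\<dots> = (1 - touched_frac E a l j) * measure lebesgue ?Q"
      using assms(1) by (simp add: touched_frac_def measure_cube field_simps)
    also have "\<dots> \<le> D * 2 powr ((real j - real J) * \<tau>) * measure lebesgue ?Q"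
      using decay[of j] by (intro mult_right_mono) auto
    finally show ?thesis .
  qed
  have cpos: "c j \<ge> 0" for j by (simp add: c_def)
  have point: "ennreal (infdist x E powr \<beta>) * indicator ?Q x \<le>
    ennreal (c J) * indicator ?Q x + (\<Sum>j<J. ennreal (c j) * indicator (A (Suc j)) x)" for x
  proof (cases "x \<in> ?Q")
    case True
    have bound: "infdist x E powr \<beta> \<le> c j" if "x \<in> touched E a l j" for j
      unfolding c_def using infdist_le_of_touched[OF assms(1) that] assms(3)
      by (intro powr_mono2) (auto simp: infdist_nonneg)
    show ?thesis
    proof (cases "x \<in> touched E a l J")
      case True
      then have "ennreal (infdist x E powr \<beta>) * indicator ?Q x \<le> ennreal (c J) * indicator ?Q x"
        by (intro mult_right_mono ennreal_leI bound) auto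
      then show ?thesis by (rule order_trans) simp
    next
      case False
      \<comment> \<open>The point is touched at index \<open>0\<close>, where the touched set is the
        whole cube, but not at \<open>J\<close>, so it drops out somewhere in between.\<close>
      have "\<exists>j<J. x \<in> touched E a l j \<and> x \<notin> touched E a l (Suc j)"
      proof (rule ccontr)
        assume *: "\<not> ?thesis"
        have "j \<le> J \<Longrightarrow> x \<in> touched E a l j" for j
          by (induction j) (use True assms * in \<open>auto simp: touched_0\<close>)
        then show False using False by blast
      qed
      then obtain j where j: "j < J" "x \<in> touched E a l j" "x \<notin> touched E a l (Suc j)" by blast
      have "ennreal (infdist x E powr \<beta>) * indicator ?Q x \<le> ennreal (c j) * indicator (A (Suc j)) x"
        using True j bound[OF j(2)] by (simp add: A_def ennreal_leI)
      also have "\<dots> \<le> (\<Sum>j<J. ennreal (c j) * indicator (A (Suc j)) x)"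
        using j(1) by (intro member_le_sum) auto
      finally show ?thesis by (rule order_trans) simp
    qed
  qed simp
  have em: "emeasure lebesgue ?Q = ennreal (measure lebesgue ?Q)"
    "emeasure lebesgue (A j) = ennreal (measure lebesgue (A j))" for j
    unfolding A_def
    by (intro emeasure_eq_measure2 fmeasurable.Diff cube_lmeasurable touched_lmeasurable assms)+
  have "(\<integral>\<^sup>+x\<in>?Q. ennreal (infdist x E powr \<beta>) \<partial>lebesgue) \<le>
    (\<integral>\<^sup>+x. ennreal (c J) * indicator ?Q x + (\<Sum>j<J. ennreal (c j) * indicator (A (Suc j)) x) \<partial>lebesgue)"
    by (rule nn_integral_mono) (rule point)
  also have "\<dots> = ennreal (c J) * emeasure lebesgue ?Q + (\<Sum>j<J. ennreal (c j) * emeasure lebesgue (A (Suc j)))"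
  proof -
    note [measurable] = meas
    have "(\<integral>\<^sup>+x. (\<Sum>j<J. ennreal (c j) * indicator (A (Suc j)) x) \<partial>lebesgue) =
      (\<Sum>j<J. \<integral>\<^sup>+x. ennreal (c j) * indicator (A (Suc j)) x \<partial>lebesgue)"
      by (rule nn_integral_sum) measurable
    moreover have "(\<integral>\<^sup>+x. ennreal (c J) * indicator ?Q x +
        (\<Sum>j<J. ennreal (c j) * indicator (A (Suc j)) x) \<partial>lebesgue) =
      (\<integral>\<^sup>+x. ennreal (c J) * indicator ?Q x \<partial>lebesgue) +
        (\<integral>\<^sup>+x. (\<Sum>j<J. ennreal (c j) * indicator (A (Suc j)) x) \<partial>lebesgue)"
      by (rule nn_integral_add) measurable
    ultimately show ?thesis by (simp only: nn_integral_cmult_indicator meas)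
  qed
  also have "\<dots> = ennreal (c J * measure lebesgue ?Q + (\<Sum>j<J. c j * measure lebesgue (A (Suc j))))"
    by (simp add: em cpos sum_nonneg ennreal_mult sum_ennreal[symmetric] del: sum_ennreal emeasure_completion)
  also have "\<dots> \<le> ennreal ((?n powr \<beta> + (2 * ?n) powr \<beta> * D / (1 - q)) * \<rho> powr \<beta> * measure lebesgue ?Q)"
  proof (rule ennreal_leI)
    have term_le: "c j * measure lebesgue (A (Suc j)) \<le>
      (2 * ?n) powr \<beta> * D * \<rho> powr \<beta> * measure lebesgue ?Q * q ^ (J - Suc j)" if "j < J" for j
    proof -
      have e: "real (Suc j) - real J = - real (J - Suc j)" using that by (simp add: of_nat_diff)
      \<comment> \<open>The shift from \<open>j\<close> to \<open>Suc j\<close> produces the extra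
        \<open>2\<close> in the constant \<open>(2 * ?n) powr \<beta>\<close>.\<close>
      have "l / 2 ^ j = 2 * \<rho> * 2 ^ (J - Suc j)"
      proof -
        have "(2::real) ^ J = 2 * 2 ^ j * 2 ^ (J - Suc j)"
          using that by (simp flip: power_Suc power_add)
        then show ?thesis by (simp add: \<rho>_def field_simps)
      qed
      then have "c j = ((2 * ?n) * \<rho> * 2 powr real (J - Suc j)) powr \<beta>"
        by (simp add: c_def powr_realpow mult_ac)
      also have "\<dots> = (2 * ?n) powr \<beta> * \<rho> powr \<beta> * 2 powr (real (J - Suc j) * \<beta>)"
        using pos by (simp add: powr_mult powr_powr)
      finally have c: "c j = (2 * ?n) powr \<beta> * \<rho> powr \<beta> * 2 powr (real (J - Suc j) * \<beta>)" .
      have "c j * measure lebesgue (A (Suc j)) \<le>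
        c j * (D * 2 powr ((real (Suc j) - real J) * \<tau>) * measure lebesgue ?Q)"
        using A[of "Suc j"] cpos by (intro mult_left_mono)
      also have "\<dots> = (2 * ?n) powr \<beta> * D * \<rho> powr \<beta> * measure lebesgue ?Q *
        (2 powr (real (J - Suc j) * \<beta>) * 2 powr (- real (J - Suc j) * \<tau>))"
        unfolding c e by (simp add: mult_ac)
      also have "2 powr (real (J - Suc j) * \<beta>) * 2 powr (- real (J - Suc j) * \<tau>) = q ^ (J - Suc j)"
        unfolding q_def powr_add[symmetric]
        by (simp add: powr_powr powr_realpow[symmetric] algebra_simps)
      finally show ?thesis .
    qed
    have "(\<Sum>j<J. c j * measure lebesgue (A (Suc j))) \<le>
      (\<Sum>j<J. (2 * ?n) powr \<beta> * D * \<rho> powr \<beta> * measure lebesgue ?Q * q ^ (J - Suc j))"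
      by (rule sum_mono) (use term_le in auto)
    also have "\<dots> = (2 * ?n) powr \<beta> * D * \<rho> powr \<beta> * measure lebesgue ?Q * (\<Sum>j<J. q ^ j)"
      unfolding sum_distrib_left[symmetric] by (subst sum.nat_diff_reindex) simp
    also have "\<dots> \<le> (2 * ?n) powr \<beta> * D * \<rho> powr \<beta> * measure lebesgue ?Q * (1 / (1 - q))"
      using q assms(5) by (intro mult_left_mono sum_power_le_inverse) auto
    moreover have "c J = ?n powr \<beta> * \<rho> powr \<beta>"
      using pos by (simp only: c_def \<rho>_def powr_mult)
    ultimately show "c J * measure lebesgue ?Q + (\<Sum>j<J. c j * measure lebesgue (A (Suc j))) \<le>
      (?n powr \<beta> + (2 * ?n) powr \<beta> * D / (1 - q)) * \<rho> powr \<beta> * measure lebesgue ?Q"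
      by (simp add: algebra_simps)
  qed
  finally show ?thesis unfolding q_def \<rho>_def .
qed

section \<open>Negative powers of the distance\<close>

text \<open>There are at most \<open>3 ^ CARD('n)\<close> offsets to a cell or one of its
  neighbours, and translation preserves volume.\<close>

lemma emeasure_UN_grid_translates_le:
  fixes A :: "(real ^ 'n) set" and h :: real
  assumes "A \<in> lmeasurable"
  defines "V \<equiv> (\<lambda>k :: 'n \<Rightarrow> int. \<chi> i. of_int (k i) * h) ` (UNIV \<rightarrow>\<^sub>E {-1, 0, 1})"
  shows "(\<Union>v\<in>V. (+) v ` A) \<in> sets lebesgue"
    and "emeasure lebesgue (\<Union>v\<in>V. (+) v ` A) \<le> ennreal (3 ^ CARD('n) * measure lebesgue A)"
proof -
  have fin: "finite V" unfolding V_def by (intro finite_imageI finite_PiE) auto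
  have "card V \<le> card ((UNIV :: 'n set) \<rightarrow>\<^sub>E {-1, 0, 1 :: int})"
    unfolding V_def by (intro card_image_le finite_PiE) auto
  also have "\<dots> = 3 ^ CARD('n)" by (simp add: card_PiE numeral_3_eq_3)
  finally have card: "card V \<le> 3 ^ CARD('n)" .
  have T: "(+) v ` A \<in> lmeasurable" "measure lebesgue ((+) v ` A) = measure lebesgue A" for v
    using assms(1) by (auto simp: measurable_translation measure_translation)
  have U: "(\<Union>v\<in>V. (+) v ` A) \<in> lmeasurable"
    using fin T by (intro fmeasurable.finite_UN) auto
  then show "(\<Union>v\<in>V. (+) v ` A) \<in> sets lebesgue" by auto
  have "measure lebesgue (\<Union>v\<in>V. (+) v ` A) \<le> (\<Sum>v\<in>V. measure lebesgue ((+) v ` A))"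
    using fin T by (intro measure_UNION_le) auto
  also have "\<dots> = card V * measure lebesgue A" by (simp add: T)
  also have "\<dots> \<le> 3 ^ CARD('n) * measure lebesgue A"
    using card by (intro mult_right_mono) (auto simp flip: of_nat_le_iff)
  finally show "emeasure lebesgue (\<Union>v\<in>V. (+) v ` A) \<le> ennreal (3 ^ CARD('n) * measure lebesgue A)"
    using U by (simp add: emeasure_eq_measure2 ennreal_leI)
qed

text \<open>For \<open>j \<ge> 2\<close> the mesh is at most \<open>l / 4\<close>, so a point of
  \<open>E\<close> within the mesh of \<open>x\<close> cannot leave \<open>cube a l\<close>, and its
  cell is touched. The cells of the two points have indices differing by at most one in each
  coordinate.\<close>

lemma mem_grid_translate_touched:
  fixes E :: "(real ^ 'n) set" and a :: "real ^ 'n"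
  assumes "l > 0" "x \<in> cube (\<chi> i. a $ i + l / 4) (l / 4)" "E \<noteq> {}" "infdist x E < l / 2 ^ j" "j \<ge> 2"
  defines "h \<equiv> l / 2 ^ j"
  shows "x \<in> (\<Union>v\<in>(\<lambda>k :: 'n \<Rightarrow> int. \<chi> i. of_int (k i) * h) ` (UNIV \<rightarrow>\<^sub>E {-1, 0, 1}).
    (+) v ` touched E a l j)"
proof -
  have h: "h > 0" using assms by (simp add: h_def)
  have h4: "h \<le> l / 4"
  proof -
    have "(2::real) ^ 2 \<le> 2 ^ j" using assms by (intro power_increasing) auto
    then have "l / 2 ^ j \<le> l / 2 ^ 2" using assms by (intro divide_left_mono) auto
    then show ?thesis by (simp add: h_def)
  qed
  obtain e where e: "e \<in> E" "dist x e < h"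
    using assms(4) infdist_notempty[OF assms(3), of x] cInf_lessD[of "dist x ` E" h] assms(3)
    by (auto simp: h_def)
  have close: "\<bar>x $ i - e $ i\<bar> < h" for i
    using component_le_norm_cart[of "x - e" i] e(2) by (simp add: dist_norm)
  have "e \<in> cube a l"
    unfolding cube_def
  proof (intro CollectI allI)
    fix i
    have "a $ i + l / 4 \<le> x $ i" "x $ i < a $ i + l / 4 + l / 4" using assms(2) by (auto simp: cube_def)
    then show "a $ i \<le> e $ i \<and> e $ i < a $ i + l" using close[of i] h4 by linarith
  qed
  then have et: "e \<in> touched E a l j"
    using e self_mem_cell unfolding touched_def by blast
  \<comment> \<open>The offset from the cell of \<open>e\<close> to that of \<open>x\<close>;
    translating back by it carries \<open>x\<close> into the cell of \<open>e\<close>.\<close>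
  define k where "k i = \<lfloor>(x $ i - a $ i) / h\<rfloor> - \<lfloor>(e $ i - a $ i) / h\<rfloor>" for i
  have k: "k i \<in> {-1, 0, 1}" for i
  proof -
    have "\<bar>(x $ i - a $ i) / h - (e $ i - a $ i) / h\<bar> < 1"
      using close[of i] h by (simp add: diff_divide_distrib[symmetric] abs_divide)
    then have "\<bar>k i\<bar> \<le> 1" unfolding k_def by linarith
    then show ?thesis by auto
  qed
  define v where "v = (\<chi> i. of_int (k i) * h)"
  have "x - v \<in> cell a h e"
    unfolding cell_def
  proof (intro CollectI allI)
    fix i
    have "((x - v) $ i - a $ i) / h = (x $ i - a $ i) / h - of_int (k i)"
      using h by (simp add: v_def field_simps)
    then show "\<lfloor>((x - v) $ i - a $ i) / h\<rfloor> = \<lfloor>(e $ i - a $ i) / h\<rfloor>"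
      by (simp only: floor_diff_of_int) (simp add: k_def)
  qed
  then have "x - v \<in> touched E a l j"
    using cell_subset_touched[OF assms(1) et] by (auto simp: h_def)
  then have "x \<in> (+) v ` touched E a l j" by (intro image_eqI[of _ _ "x - v"]) auto
  moreover have "v \<in> (\<lambda>k. \<chi> i. of_int (k i) * h) ` (UNIV \<rightarrow>\<^sub>E {-1, 0, 1})"
    unfolding v_def using k by (intro imageI) auto
  ultimately show ?thesis by blast
qed

abbreviation (input) infdist_weight :: "(real ^ 'n) set \<Rightarrow> real \<Rightarrow> real ^ 'n \<Rightarrow> ennreal" where
  "infdist_weight E \<alpha> x \<equiv> ennpowr (ennreal (infdist x E)) (- \<alpha>)"

lemma infdist_weight_eq:
  assumes "\<alpha> > 0"
  shows "infdist_weight E \<alpha> x = (if infdist x E = 0 then \<infinity> else ennreal (infdist x E powr (- \<alpha>)))"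
  using assms infdist_nonneg[of x E] by (auto simp: ennpowr_def)

text \<open>The conventions agree at distance \<open>0\<close>: infinity to a negative power is
  \<open>0\<close>, and so is a real power of \<open>0\<close>. Elsewhere the exponents
  multiply.\<close>

lemma ennpowr_infdist_weight:
  assumes "\<alpha> > 0" "p > 1"
  shows "ennpowr (infdist_weight E \<alpha> x) (- 1 / (p - 1)) = ennreal (infdist x E powr (\<alpha> / (p - 1)))"
proof (cases "infdist x E = 0")
  case False
  then have "infdist x E > 0" using infdist_nonneg[of x E] by linarith
  then show ?thesis
    using assms unfolding infdist_weight_eq[OF assms(1)]
    by (simp add: ennpowr_def powr_powr ennreal_eq_0_iff not_le)
qed (use assms in \<open>simp add: infdist_weight_eq ennpowr_def divide_less_0_iff\<close>)

lemma infdist_weight_measurable: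
  assumes "\<alpha> > 0"
  shows "infdist_weight E \<alpha> \<in> borel_measurable lebesgue"
proof -
  have "(\<lambda>x. infdist x E) \<in> borel_measurable borel"
    by (intro borel_measurable_continuous_onI continuous_intros)
  then have [measurable]: "(\<lambda>x. infdist x E) \<in> borel_measurable lebesgue"
    by (simp add: borel_measurable_if_I measurable_completion)
  show ?thesis unfolding infdist_weight_eq[OF assms, abs_def] by measurable
qed

text \<open>Locates the dyadic shell of a small distance; the strict upper bound matches the
  hypothesis of \<open>mem_grid_translate_touched\<close>.\<close>

lemma scale_bracket:
  fixes d r :: real
  assumes "0 < d" "d < r"
  obtains k :: nat where "r / 2 ^ Suc k \<le> d" "d < r / 2 ^ k"
proof -
  have "(\<lambda>k. r / 2 ^ k) \<longlonglongrightarrow> 0" by (rule LIMSEQ_divide_realpow_zero) simp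
  from order_tendstoD(2)[OF this assms(1)] obtain N where N: "r / 2 ^ N \<le> d"
    unfolding eventually_sequentially by (auto intro: less_imp_le)
  define m where "m = (LEAST k. r / 2 ^ k \<le> d)"
  have m: "r / 2 ^ m \<le> d" unfolding m_def by (rule LeastI[where P = "\<lambda>k. r / 2 ^ k \<le> d", OF N])
  have "m \<noteq> 0" using m assms by (cases "m = 0") auto
  then obtain k where k: "m = Suc k" using not0_implies_Suc by blast
  have "\<not> r / 2 ^ k \<le> d" using not_less_Least[of k "\<lambda>k. r / 2 ^ k \<le> d"] k by (simp add: m_def)
  then show ?thesis using that[of k] m k by simp
qed

text \<open>The margins are \<open>s\<close> below and \<open>2 * s\<close> above, so the larger
  cube is not exactly concentric; instead the smaller one is a dyadic subcube of generation
  \<open>2\<close>.\<close>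

lemma cube_subset_concentric:
  assumes "0 \<le> s"
  shows "cube b s \<subseteq> cube (\<chi> i. b $ i - s) (4 * s)"
proof
  fix x assume x: "x \<in> cube b s"
  have "b $ i - s \<le> x $ i \<and> x $ i < b $ i - s + 4 * s" for i
  proof -
    have "b $ i \<le> x $ i" "x $ i < b $ i + s" using x by (auto simp: cube_def)
    then show ?thesis using assms by simp
  qed
  then show "x \<in> cube (\<chi> i. b $ i - s) (4 * s)" by (simp add: cube_def)
qed

text \<open>Within \<open>Q\<close>, the shell where the distance lies between
  \<open>r / 2 ^ Suc k\<close> and \<open>r / 2 ^ k\<close> is covered by the translates
  \<open>B k\<close>. Their volume decays like \<open>2 powr (- (k * \<tau>))\<close> while the
  weight grows like \<open>2 powr (k * \<alpha>)\<close>, which is summable as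
  \<open>\<alpha> < \<tau>\<close>.\<close>

lemma nn_integral_infdist_weight_le:
  fixes E :: "(real ^ 'n) set" and a :: "real ^ 'n" and l \<alpha> \<tau> D :: real
  assumes "l > 0" "closed E" "E \<noteq> {}" "emeasure lebesgue E = 0" "0 < \<alpha>" "\<alpha> < \<tau>" "D \<ge> 0" "J \<ge> 1"
    and decay: "\<And>j. touched_frac E a l j \<le> D * 2 powr ((real J - real j) * \<tau>)"
  defines "Q \<equiv> cube (\<chi> i. a $ i + l / 4) (l / 4)"
  shows "(\<integral>\<^sup>+x\<in>Q. infdist_weight E \<alpha> x \<partial>lebesgue) \<le>
    ennreal ((2 powr \<alpha> + 3 ^ CARD('n) * D * 4 powr \<alpha> / (1 - 2 powr (\<alpha> - \<tau>)))
      * (l / 2 ^ J) powr (- \<alpha>) * measure lebesgue (cube a l))"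
proof -
  \<comment> \<open>Starting at \<open>Suc J\<close> with \<open>J \<ge> 1\<close> ensures that
    every generation used is at least \<open>2\<close>.\<close>
  define r where "r = l / 2 ^ Suc J"
  define B where "B k = (\<Union>v\<in>(\<lambda>i :: 'n \<Rightarrow> int. \<chi> s. of_int (i s) * (l / 2 ^ (Suc J + k))) `
    (UNIV \<rightarrow>\<^sub>E {-1, 0, 1}). (+) v ` touched E a l (Suc J + k))" for k
  define c where "c k = (r / 2 ^ Suc k) powr (- \<alpha>)" for k
  define q where "q = 2 powr (\<alpha> - \<tau>)"
  define M where "M = measure lebesgue (cube a l)"
  have q: "0 < q" "q < 1" using assms by (auto simp: q_def powr_less_one)
  have r: "r > 0" using assms by (simp add: r_def)
  have M: "M > 0" using assms by (simp add: M_def measure_cube)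
  have Bm: "B k \<in> sets lebesgue" for k
    unfolding B_def by (intro emeasure_UN_grid_translates_le touched_lmeasurable assms)
  have Be: "emeasure lebesgue (B k) \<le> ennreal (3 ^ CARD('n) * D * 2 powr (- (real k * \<tau>)) * M)" for k
  proof -
    have "emeasure lebesgue (B k) \<le> ennreal (3 ^ CARD('n) * measure lebesgue (touched E a l (Suc J + k)))"
      unfolding B_def by (intro emeasure_UN_grid_translates_le touched_lmeasurable assms)
    also have "\<dots> \<le> ennreal (3 ^ CARD('n) * (D * 2 powr (- (real k * \<tau>)) * M))"
    proof (intro ennreal_leI mult_left_mono)
      have "measure lebesgue (touched E a l (Suc J + k)) = touched_frac E a l (Suc J + k) * M"
        using M by (simp add: touched_frac_def M_def)
      also have "\<dots> \<le> D * 2 powr (- (real k * \<tau>)) * M"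
      proof (intro mult_right_mono order_trans[OF decay] mult_left_mono powr_mono)
        \<comment> \<open>The left side is \<open>- (1 + k) * \<tau>\<close>; one factor
          \<open>2 powr (- \<tau>)\<close> is given away.\<close>
        show "(real J - real (Suc J + k)) * \<tau> \<le> - (real k * \<tau>)"
          using assms by (simp add: algebra_simps)
      qed (use assms M in auto)
      finally show "measure lebesgue (touched E a l (Suc J + k)) \<le> D * 2 powr (- (real k * \<tau>)) * M" .
    qed simp
    finally show ?thesis by (simp add: mult_ac)
  qed
  have point: "infdist_weight E \<alpha> x * indicator Q x \<le>
    ennreal (r powr (- \<alpha>)) * indicator Q x + (\<Sum>k. ennreal (c k) * indicator (B k) x)" if "x \<notin> E" for x
  proof (cases "x \<in> Q")
    case True
    have d: "infdist x E > 0"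
      using that in_closed_iff_infdist_zero[OF assms(2,3)] infdist_nonneg[of x E] by fastforce
    then have w: "infdist_weight E \<alpha> x = ennreal (infdist x E powr (- \<alpha>))"
      using assms(5) by (simp add: infdist_weight_eq)
    show ?thesis
    proof (cases "infdist x E < r")
      case False
      then have "infdist_weight E \<alpha> x * indicator Q x \<le> ennreal (r powr (- \<alpha>)) * indicator Q x"
        using r assms(5) unfolding w by (intro mult_right_mono ennreal_leI powr_mono2') auto
      then show ?thesis by (rule order_trans) simp
    next
      case lt: True
      obtain k where k: "r / 2 ^ Suc k \<le> infdist x E" "infdist x E < r / 2 ^ k"
        using scale_bracket[OF d lt] .
      have "infdist x E < l / 2 ^ (Suc J + k)" using k(2) by (simp add: r_def power_add)
      then have "x \<in> B k"
        unfolding B_def using True assms(8)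
        by (intro mem_grid_translate_touched[OF assms(1) _ assms(3)]) (auto simp: Q_def)
      moreover have "infdist x E powr (- \<alpha>) \<le> c k"
        unfolding c_def using k(1) r assms(5) by (intro powr_mono2') auto
      ultimately have "infdist_weight E \<alpha> x * indicator Q x \<le> ennreal (c k) * indicator (B k) x"
        using True by (simp add: w ennreal_leI)
      also have "\<dots> \<le> (\<Sum>k. ennreal (c k) * indicator (B k) x)"
        using sum_le_suminf[OF summableI, of "{k}" "\<lambda>k. ennreal (c k) * indicator (B k) x"]
        by (simp del: sum_mult_indicator)
      finally show ?thesis by (rule order_trans) simp
    qed
  qed simp
  have Qm: "Q \<in> lmeasurable" unfolding Q_def by (rule cube_lmeasurable)
  have QM: "measure lebesgue Q \<le> M"
    unfolding M_def
  proof (rule measure_mono_fmeasurable[OF _ fmeasurableD[OF Qm] cube_lmeasurable])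
    have "a = (\<chi> i. (\<chi> i. a $ i + l / 4) $ i - l / 4)" by (simp add: vec_eq_iff)
    then show "Q \<subseteq> cube a l"
      using cube_subset_concentric[of "l / 4" "\<chi> i. a $ i + l / 4"] assms(1) by (simp add: Q_def)
  qed
  \<comment> \<open>The weight is infinite on \<open>E\<close>, so the pointwise bound is used only
    off this null set.\<close>
  have AE: "AE x in lebesgue. x \<notin> E"
  proof (rule AE_not_in)
    have "E \<in> sets lebesgue" using borel_closed[OF assms(2)] by simp
    then show "E \<in> null_sets lebesgue" using assms(4) by (rule null_setsI[rotated])
  qed
  have "(\<integral>\<^sup>+x\<in>Q. infdist_weight E \<alpha> x \<partial>lebesgue) \<le>
    (\<integral>\<^sup>+x. ennreal (r powr (- \<alpha>)) * indicator Q x + (\<Sum>k. ennreal (c k) * indicator (B k) x) \<partial>lebesgue)"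
    by (rule nn_integral_mono_AE) (use AE point in \<open>auto elim!: eventually_mono\<close>)
  also have "\<dots> = ennreal (r powr (- \<alpha>)) * emeasure lebesgue Q + (\<Sum>k. ennreal (c k) * emeasure lebesgue (B k))"
  proof -
    note [measurable] = Bm fmeasurableD[OF Qm]
    have "(\<integral>\<^sup>+x. (\<Sum>k. ennreal (c k) * indicator (B k) x) \<partial>lebesgue) =
      (\<Sum>k. \<integral>\<^sup>+x. ennreal (c k) * indicator (B k) x \<partial>lebesgue)"
      by (rule nn_integral_suminf) measurable
    moreover have "(\<integral>\<^sup>+x. ennreal (r powr (- \<alpha>)) * indicator Q x +
        (\<Sum>k. ennreal (c k) * indicator (B k) x) \<partial>lebesgue) =
      (\<integral>\<^sup>+x. ennreal (r powr (- \<alpha>)) * indicator Q x \<partial>lebesgue) +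
        (\<integral>\<^sup>+x. (\<Sum>k. ennreal (c k) * indicator (B k) x) \<partial>lebesgue)"
      by (rule nn_integral_add) measurable
    ultimately show ?thesis by (simp only: nn_integral_cmult_indicator Bm fmeasurableD[OF Qm])
  qed
  also have "\<dots> \<le> ennreal (r powr (- \<alpha>)) * ennreal M +
    (\<Sum>k. ennreal (3 ^ CARD('n) * D * (r / 2) powr (- \<alpha>) * M * q ^ k))"
  proof (intro add_mono mult_left_mono suminf_le)
    show "emeasure lebesgue Q \<le> ennreal M"
      using QM Qm by (simp add: emeasure_eq_measure2 ennreal_leI del: emeasure_completion)
    fix k
    have "c k = ((r / 2) * 2 powr (- real k)) powr (- \<alpha>)"
      by (simp add: c_def powr_minus powr_realpow field_simps)
    also have "\<dots> = (r / 2) powr (- \<alpha>) * 2 powr (real k * \<alpha>)"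
      using r by (subst powr_mult) (auto simp: powr_powr)
    finally have c: "c k = (r / 2) powr (- \<alpha>) * 2 powr (real k * \<alpha>)" .
    have "ennreal (c k) * emeasure lebesgue (B k) \<le>
      ennreal (c k) * ennreal (3 ^ CARD('n) * D * 2 powr (- (real k * \<tau>)) * M)"
      by (intro mult_left_mono Be) auto
    also have "\<dots> = ennreal (3 ^ CARD('n) * D * (r / 2) powr (- \<alpha>) * M *
      (2 powr (real k * \<alpha>) * 2 powr (- (real k * \<tau>))))"
      using assms(7) M by (simp add: c mult_ac flip: ennreal_mult)
    also have "2 powr (real k * \<alpha>) * 2 powr (- (real k * \<tau>)) = q ^ k"
      unfolding q_def powr_add[symmetric]
      by (simp add: powr_powr powr_realpow[symmetric] algebra_simps)
    finally show "ennreal (c k) * emeasure lebesgue (B k) \<le>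
      ennreal (3 ^ CARD('n) * D * (r / 2) powr (- \<alpha>) * M * q ^ k)" .
  qed auto
  also have "(\<Sum>k. ennreal (3 ^ CARD('n) * D * (r / 2) powr (- \<alpha>) * M * q ^ k)) =
    ennreal (3 ^ CARD('n) * D * (r / 2) powr (- \<alpha>) * M * (1 / (1 - q)))"
    using q assms(7) M by (subst suminf_ennreal2) (auto simp: suminf_mult suminf_geometric summable_geometric)
  also have "ennreal (r powr (- \<alpha>)) * ennreal M + \<dots> =
    ennreal (r powr (- \<alpha>) * M + 3 ^ CARD('n) * D * (r / 2) powr (- \<alpha>) * M * (1 / (1 - q)))"
    using q assms(7) M by (simp flip: ennreal_mult ennreal_plus)
  also have "r powr (- \<alpha>) * M + 3 ^ CARD('n) * D * (r / 2) powr (- \<alpha>) * M * (1 / (1 - q)) =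
    (2 powr \<alpha> + 3 ^ CARD('n) * D * 4 powr \<alpha> / (1 - q)) * (l / 2 ^ J) powr (- \<alpha>) * M"
  proof -
    \<comment> \<open>With \<open>\<rho> = l / 2 ^ J\<close> one has \<open>r = \<rho> / 2\<close>
      and \<open>r / 2 = \<rho> / 4\<close>, whence the factors \<open>2 powr \<alpha>\<close> and
      \<open>4 powr \<alpha>\<close>.\<close>
    have "r powr (- \<alpha>) = 2 powr \<alpha> * (l / 2 ^ J) powr (- \<alpha>)"
      "(r / 2) powr (- \<alpha>) = 4 powr \<alpha> * (l / 2 ^ J) powr (- \<alpha>)"
      using assms(1) by (simp_all add: r_def powr_minus powr_divide powr_mult field_simps flip: powr_mult)
    then show ?thesis by (simp add: algebra_simps)
  qed
  finally show ?thesis unfolding q_def M_def .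
qed

section \<open>Cube averages near to and far from the set\<close>

lemma cube_average_le:
  assumes "l > 0" "(\<integral>\<^sup>+x\<in>cube a l. f x \<partial>lebesgue) \<le> ennreal (c * measure lebesgue (cube a l))" "c \<ge> 0"
  shows "cube_average (cube a l) f \<le> ennreal c"
proof -
  have pos: "measure lebesgue (cube a l) > 0" using assms(1) by (simp add: measure_cube)
  have "cube_average (cube a l) f \<le>
    ennreal (c * measure lebesgue (cube a l)) / ennreal (measure lebesgue (cube a l))"
    unfolding cube_average_def emeasure_eq_measure2[OF cube_lmeasurable]
    by (rule divide_right_mono_ennreal[OF assms(2)])
  also have "\<dots> = ennreal c" using pos assms(3) by (subst divide_ennreal) auto
  finally show ?thesis .
qed

lemma ennpowr_le:
  assumes "x \<le> ennreal c" "c > 0" "s > 0"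
  shows "ennpowr x s \<le> ennreal (c powr s)"
proof (cases "x = 0")
  case False
  have "x \<noteq> \<infinity>" using assms(1) by (auto simp: top_unique)
  moreover have "enn2real x powr s \<le> c powr s"
    using assms enn2real_mono[OF assms(1)] by (intro powr_mono2) auto
  ultimately show ?thesis using False assms by (simp add: ennpowr_def ennreal_leI)
qed (use assms in \<open>simp add: ennpowr_def\<close>)

text \<open>Raising the second bound to the power \<open>p - 1\<close> gives
  \<open>\<rho> powr \<alpha>\<close>, which cancels \<open>\<rho> powr (- \<alpha>)\<close>; the
  result does not depend on the cube.\<close>

lemma averages_product_le:
  fixes K K' \<rho> \<alpha> p :: real
  assumes "p > 1" "\<rho> > 0" "K > 0" "K' > 0"
    and "u \<le> ennreal (K * \<rho> powr (- \<alpha>))" "v \<le> ennreal (K' * \<rho> powr (\<alpha> / (p - 1)))"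
  shows "u * ennpowr v (p - 1) \<le> ennreal (K * K' powr (p - 1))"
proof -
  have "u * ennpowr v (p - 1) \<le>
    ennreal (K * \<rho> powr (- \<alpha>)) * ennreal ((K' * \<rho> powr (\<alpha> / (p - 1))) powr (p - 1))"
    using assms by (intro mult_mono ennpowr_le) auto
  also have "\<dots> = ennreal (K * \<rho> powr (- \<alpha>) * (K' * \<rho> powr (\<alpha> / (p - 1))) powr (p - 1))"
    using assms by (simp add: ennreal_mult)
  also have "K * \<rho> powr (- \<alpha>) * (K' * \<rho> powr (\<alpha> / (p - 1))) powr (p - 1) = K * K' powr (p - 1)"
  proof -
    have "(K' * \<rho> powr (\<alpha> / (p - 1))) powr (p - 1) = K' powr (p - 1) * \<rho> powr \<alpha>"
      using assms by (simp add: powr_mult powr_powr)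
    moreover have "\<rho> powr (- \<alpha>) * \<rho> powr \<alpha> = 1"
      using assms by (simp flip: powr_add)
    ultimately show ?thesis by (simp add: mult_ac)
  qed
  finally show ?thesis .
qed

text \<open>Both integral estimates are applied to the fourfold enlargement with the same critical
  scale \<open>\<rho>\<close>, while \<open>K\<close> and \<open>K'\<close> are fixed before the
  cube. The common \<open>\<rho>\<close> is what lets the product be bounded uniformly.\<close>

lemma averages_near:
  fixes E :: "(real ^ 'n) set" and \<sigma> C \<alpha> p :: real
  assumes "closed E" "E \<noteq> {}" "emeasure lebesgue E = 0" "\<sigma> > 0" "C > 0"
    and LS: "\<And>Q0 t. Q0 \<in> cubes \<Longrightarrow> Q0 \<inter> E \<noteq> {} \<Longrightarrow> 0 < t \<Longrightarrow> t < 1 \<Longrightarrow>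
           L_large E Q0 t \<le> C / t powr \<sigma> * S_small E Q0 t"
    and \<alpha>: "p > 1" "0 < \<alpha>" "\<alpha> < 1 / \<sigma>" "\<alpha> / (p - 1) < 1 / \<sigma>"
  shows "\<exists>K>0. \<exists>K'>0. \<forall>b. \<forall>s>0. cube (\<chi> i. b $ i - s) (4 * s) \<inter> E \<noteq> {} \<longrightarrow> (\<exists>\<rho>>0.
      cube_average (cube b s) (infdist_weight E \<alpha>) \<le> ennreal (K * \<rho> powr (- \<alpha>)) \<and>
      cube_average (cube b s) (\<lambda>x. ennreal (infdist x E powr (\<alpha> / (p - 1)))) \<le>
        ennreal (K' * \<rho> powr (\<alpha> / (p - 1))))"
proof -
  define \<beta> where "\<beta> = \<alpha> / (p - 1)"
  define \<tau> where "\<tau> = 1 / \<sigma>"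
  define D where "D = 2 * C powr (1 / \<sigma>)"
  have \<beta>: "0 < \<beta>" "\<beta> < \<tau>" "0 < \<alpha>" "\<alpha> < \<tau>" using \<alpha> by (auto simp: \<beta>_def \<tau>_def)
  have D: "D \<ge> 0" by (simp add: D_def)
  \<comment> \<open>The factor \<open>4 ^ CARD('n)\<close> is the volume ratio between the
    enlargement and the given cube.\<close>
  define K where "K = 4 ^ CARD('n) * (2 powr \<alpha> + 3 ^ CARD('n) * D * 4 powr \<alpha> / (1 - 2 powr (\<alpha> - \<tau>)))"
  define K' where "K' = 4 ^ CARD('n) *
    (CARD('n) powr \<beta> + (2 * real CARD('n)) powr \<beta> * D / (1 - 2 powr (\<beta> - \<tau>)))"
  have q: "2 powr (\<alpha> - \<tau>) < 1" "2 powr (\<beta> - \<tau>) < 1" using \<beta> by (simp_all add: powr_less_one)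
  have K: "K > 0" "K' > 0" unfolding K_def K'_def using D q
    by (auto intro!: mult_pos_pos add_pos_nonneg divide_nonneg_pos mult_nonneg_nonneg)
  have "\<exists>\<rho>>0. cube_average (cube b s) (infdist_weight E \<alpha>) \<le> ennreal (K * \<rho> powr (- \<alpha>)) \<and>
      cube_average (cube b s) (\<lambda>x. ennreal (infdist x E powr (\<alpha> / (p - 1)))) \<le>
        ennreal (K' * \<rho> powr (\<alpha> / (p - 1)))"
    if s: "s > 0" and meet: "cube (\<chi> i. b $ i - s) (4 * s) \<inter> E \<noteq> {}" for b s
  proof -
    define a where "a = (\<chi> i. b $ i - s)"
    define l where "l = 4 * s"
    have l: "l > 0" and meet: "cube a l \<inter> E \<noteq> {}" using s meet by (simp_all add: a_def l_def)
    have Q: "cube b s = cube (\<chi> i. a $ i + l / 4) (l / 4)"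
      by (simp add: cube_def a_def l_def)
    have sub: "cube b s \<subseteq> cube a l"
      unfolding a_def l_def using s by (intro cube_subset_concentric) simp
    have vol: "measure lebesgue (cube a l) = 4 ^ CARD('n) * measure lebesgue (cube b s)"
      using s by (simp add: l_def measure_cube power_mult_distrib)
    obtain J where J: "J \<ge> 1"
      "\<And>j. touched_frac E a l j \<le> D * 2 powr ((real J - real j) * \<tau>)"
      "\<And>j. 1 - touched_frac E a l j \<le> D * 2 powr ((real j - real J) * \<tau>)"
      unfolding D_def \<tau>_def
      by (rule touched_frac_decay[OF l assms(1,3) meet assms(4,5) LS[OF cube_in_cubes[OF l] meet]]) blast+
    define \<rho> where "\<rho> = l / 2 ^ J"
    have \<rho>: "\<rho> > 0" using l by (simp add: \<rho>_def)
    have "(\<integral>\<^sup>+x\<in>cube b s. infdist_weight E \<alpha> x \<partial>lebesgue) \<le>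
      ennreal (K * \<rho> powr (- \<alpha>) * measure lebesgue (cube b s))"
      using nn_integral_infdist_weight_le[OF l assms(1-3) \<beta>(3,4) D J(1,2)]
      unfolding Q[symmetric] vol by (simp add: K_def \<rho>_def mult_ac)
    then have 1: "cube_average (cube b s) (infdist_weight E \<alpha>) \<le> ennreal (K * \<rho> powr (- \<alpha>))"
      by (rule cube_average_le[OF s]) (use K in auto)
    have "(\<integral>\<^sup>+x\<in>cube b s. ennreal (infdist x E powr \<beta>) \<partial>lebesgue) \<le>
      (\<integral>\<^sup>+x\<in>cube a l. ennreal (infdist x E powr \<beta>) \<partial>lebesgue)"
      using sub by (intro nn_integral_mono mult_left_mono) (auto simp: indicator_def)
    also have "\<dots> \<le> ennreal (K' * \<rho> powr \<beta> * measure lebesgue (cube b s))"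
      using nn_integral_infdist_powr_le[OF l meet \<beta>(1,2) D J(3)]
      unfolding vol by (simp add: K'_def \<rho>_def mult_ac)
    finally have "cube_average (cube b s) (\<lambda>x. ennreal (infdist x E powr \<beta>)) \<le> ennreal (K' * \<rho> powr \<beta>)"
      by (rule cube_average_le[OF s]) (use K in auto)
    with 1 \<rho> show ?thesis
      unfolding \<beta>_def by blast
  qed
  then show ?thesis using K by blast
qed

text \<open>The margin keeps the cube at distance at least \<open>s\<close> from \<open>E\<close>,
  and its points are within \<open>CARD('n) * s\<close> of the corner \<open>b\<close>. Hence the
  distance to \<open>E\<close> agrees with \<open>infdist b E\<close> up to the factor
  \<open>1 + CARD('n)\<close>.\<close>

lemma averages_far:
  fixes E :: "(real ^ 'n) set" and b :: "real ^ 'n" and s \<alpha> \<beta> :: real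
  assumes "E \<noteq> {}" "s > 0" "cube (\<chi> i. b $ i - s) (4 * s) \<inter> E = {}" "\<alpha> > 0" "\<beta> > 0"
  shows "\<exists>\<rho>>0. cube_average (cube b s) (infdist_weight E \<alpha>) \<le>
      ennreal ((1 + real CARD('n)) powr \<alpha> * \<rho> powr (- \<alpha>)) \<and>
    cube_average (cube b s) (\<lambda>x. ennreal (infdist x E powr \<beta>)) \<le>
      ennreal ((1 + real CARD('n)) powr \<beta> * \<rho> powr \<beta>)"
proof (intro exI[of _ "infdist b E"] conjI)
  let ?n = "real CARD('n)" and ?\<rho> = "infdist b E"
  have far: "s \<le> infdist x E" if x: "x \<in> cube b s" for x
  proof -
    have "s \<le> dist x e" if e: "e \<in> E" for e
    proof -
      have "e \<notin> cube (\<chi> i. b $ i - s) (4 * s)" using assms(3) e by blast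
      then obtain i where "\<not> (b $ i - s \<le> e $ i \<and> e $ i < b $ i - s + 4 * s)"
        by (auto simp: cube_def)
      moreover have "b $ i \<le> x $ i" "x $ i < b $ i + s" using x by (auto simp: cube_def)
      ultimately have "s \<le> \<bar>(x - e) $ i\<bar>" using assms(2) by auto
      also have "\<dots> \<le> dist x e" unfolding dist_norm by (rule component_le_norm_cart)
      finally show ?thesis .
    qed
    then show ?thesis
      unfolding infdist_notempty[OF assms(1)] using assms(1) by (intro cINF_greatest)
  qed
  have "b \<in> cube b s" using assms(2) by (simp add: cube_def)
  then have b: "s \<le> ?\<rho>" by (rule far)
  then show pos: "?\<rho> > 0" using assms(2) by simp
  have close: "dist x b \<le> ?n * s" if x: "x \<in> cube b s" for x
  proof -
    have "dist x b \<le> (\<Sum>i\<in>UNIV. \<bar>(x - b) $ i\<bar>)"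
      unfolding dist_norm by (rule norm_le_l1_cart)
    also have "\<dots> \<le> (\<Sum>i\<in>(UNIV::'n set). s)"
    proof (rule sum_mono)
      fix i
      have "b $ i \<le> x $ i" "x $ i < b $ i + s" using x by (auto simp: cube_def)
      then show "\<bar>(x - b) $ i\<bar> \<le> s" by simp
    qed
    finally show ?thesis by simp
  qed
  have lower: "?\<rho> / (1 + ?n) \<le> infdist x E" if x: "x \<in> cube b s" for x
  proof -
    have "?\<rho> \<le> infdist x E + ?n * s"
      using infdist_triangle[of b E x] close[OF x] by (simp add: dist_commute)
    also have "\<dots> \<le> infdist x E + ?n * infdist x E"
      using far[OF x] by (intro add_left_mono mult_left_mono) auto
    finally show ?thesis by (simp add: field_simps)
  qed
  have upper: "infdist x E \<le> (1 + ?n) * ?\<rho>" if x: "x \<in> cube b s" for x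
  proof -
    have "infdist x E \<le> ?\<rho> + ?n * s"
      using infdist_triangle[of x E b] close[OF x] by simp
    also have "\<dots> \<le> ?\<rho> + ?n * ?\<rho>"
      using b by (intro add_left_mono mult_left_mono) auto
    finally show ?thesis by (simp add: algebra_simps)
  qed
  have const: "cube_average (cube b s) f \<le> ennreal c"
    if "\<And>x. x \<in> cube b s \<Longrightarrow> f x \<le> ennreal c" "c \<ge> 0" for f c
  proof (rule cube_average_le[OF assms(2) _ that(2)])
    have "(\<integral>\<^sup>+x\<in>cube b s. f x \<partial>lebesgue) \<le> (\<integral>\<^sup>+x. ennreal c * indicator (cube b s) x \<partial>lebesgue)"
      using that(1) by (intro nn_integral_mono) (auto simp: indicator_def)
    also have "\<dots> = ennreal c * emeasure lebesgue (cube b s)"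
      by (rule nn_integral_cmult_indicator[OF fmeasurableD[OF cube_lmeasurable]])
    also have "\<dots> = ennreal (c * measure lebesgue (cube b s))"
      using that(2) by (simp only: emeasure_eq_measure2[OF cube_lmeasurable] ennreal_mult[symmetric] measure_nonneg)
    finally show "(\<integral>\<^sup>+x\<in>cube b s. f x \<partial>lebesgue) \<le> ennreal (c * measure lebesgue (cube b s))" .
  qed
  show "cube_average (cube b s) (infdist_weight E \<alpha>) \<le> ennreal ((1 + ?n) powr \<alpha> * ?\<rho> powr (- \<alpha>))"
  proof (rule const)
    fix x assume x: "x \<in> cube b s"
    have "infdist x E \<noteq> 0" using far[OF x] assms(2) by simp
    moreover have "infdist x E powr (- \<alpha>) \<le> (?\<rho> / (1 + ?n)) powr (- \<alpha>)"
      using lower[OF x] pos assms(4) by (intro powr_mono2') auto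
    moreover have "(?\<rho> / (1 + ?n)) powr (- \<alpha>) = (1 + ?n) powr \<alpha> * ?\<rho> powr (- \<alpha>)"
      using pos by (simp add: powr_divide powr_minus field_simps)
    ultimately show "infdist_weight E \<alpha> x \<le> ennreal ((1 + ?n) powr \<alpha> * ?\<rho> powr (- \<alpha>))"
      using assms(4) by (simp add: infdist_weight_eq ennreal_leI)
  qed simp
  show "cube_average (cube b s) (\<lambda>x. ennreal (infdist x E powr \<beta>)) \<le> ennreal ((1 + ?n) powr \<beta> * ?\<rho> powr \<beta>)"
  proof (rule const)
    fix x assume x: "x \<in> cube b s"
    have "infdist x E powr \<beta> \<le> ((1 + ?n) * ?\<rho>) powr \<beta>"
      using upper[OF x] assms(5) by (intro powr_mono2) (auto simp: infdist_nonneg)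
    then show "ennreal (infdist x E powr \<beta>) \<le> ennreal ((1 + ?n) powr \<beta> * ?\<rho> powr \<beta>)"
      using pos by (simp add: powr_mult ennreal_leI)
  qed simp
qed

section \<open>Local integrability of the weight and the \<open>A_p\<close> bound over all
  cubes\<close>

theorem theorem4p2:
  fixes E :: "(real ^ 'n) set" and \<sigma> C0 :: real
  assumes "closed E" and "E \<noteq> {}" and "emeasure lebesgue E = 0"
    and "\<sigma> > 0" and "C0 > 0"
    and "\<And>Q0 t. Q0 \<in> cubes \<Longrightarrow> Q0 \<inter> E \<noteq> {} \<Longrightarrow> 0 < t \<Longrightarrow> t < 1 \<Longrightarrow>
           L_large E Q0 t \<le> C0 / t powr \<sigma> * S_small E Q0 t"
  shows "\<forall>p>1. \<forall>\<alpha>. 0 < \<alpha> \<and> \<alpha> < min (inverse \<sigma>) ((p - 1) * inverse \<sigma>) \<longrightarrow>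
           (\<lambda>x. ennpowr (ennreal (infdist x E)) (- \<alpha>)) \<in> Muckenhoupt p"
proof (intro allI impI, elim conjE)
  fix p \<alpha> :: real
  assume p: "p > 1" and \<alpha>: "0 < \<alpha>" "\<alpha> < min (inverse \<sigma>) ((p - 1) * inverse \<sigma>)"
  \<comment> \<open>The first bound serves the weight, the second its dual power with exponent
    \<open>\<alpha> / (p - 1)\<close>.\<close>
  have ex: "\<alpha> < 1 / \<sigma>" "\<alpha> / (p - 1) < 1 / \<sigma>"
    using \<alpha> p by (auto simp: inverse_eq_divide pos_divide_less_eq mult.commute)
  obtain K K' where K: "K > 0" "K' > 0" and near:
    "\<And>b s. s > 0 \<Longrightarrow> cube (\<chi> i. b $ i - s) (4 * s) \<inter> E \<noteq> {} \<Longrightarrow> \<exists>\<rho>>0.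
      cube_average (cube b s) (infdist_weight E \<alpha>) \<le> ennreal (K * \<rho> powr (- \<alpha>)) \<and>
      cube_average (cube b s) (\<lambda>x. ennreal (infdist x E powr (\<alpha> / (p - 1)))) \<le>
        ennreal (K' * \<rho> powr (\<alpha> / (p - 1)))"
    using averages_near[OF assms p \<alpha>(1) ex] by blast
  define N where "N = 1 + real CARD('n)"
  have N: "N > 0" by (simp add: N_def)
  \<comment> \<open>The two entries are the product bounds for cubes near \<open>E\<close> and far
    from \<open>E\<close>.\<close>
  define M where "M = max (K * K' powr (p - 1)) (N powr \<alpha> * (N powr (\<alpha> / (p - 1))) powr (p - 1))"
  have "weight (infdist_weight E \<alpha>)"
    unfolding weight_def
  proof (intro conjI allI impI)
    show "infdist_weight E \<alpha> \<in> borel_measurable lebesgue"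
      by (rule infdist_weight_measurable[OF \<alpha>(1)])
    show "AE x in lebesgue. 0 < infdist_weight E \<alpha> x"
      using \<alpha>(1) infdist_nonneg[of _ E]
      by (intro AE_I2) (auto simp: infdist_weight_eq less_le)
    fix A :: "(real ^ 'n) set" assume "compact A"
    obtain e where e: "e \<in> E" using assms(2) by blast
    \<comment> \<open>Adding a point \<open>e\<close> of \<open>E\<close> to the compact set
      guarantees that the enclosing cube falls under the estimate \<open>near\<close>.\<close>
    have "bounded (insert e A)" using \<open>compact A\<close> by (simp add: compact_imp_bounded)
    then obtain R where R: "R > 0" "\<And>x. x \<in> insert e A \<Longrightarrow> norm x < R"
      by (metis bounded_pos_less)
    define b :: "real ^ 'n" where "b = (\<chi> i. - R)"
    have sub: "insert e A \<subseteq> cube b (2 * R)"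
    proof
      fix x assume x: "x \<in> insert e A"
      have "- R \<le> x $ i \<and> x $ i < - R + 2 * R" for i
      proof -
        have "\<bar>x $ i\<bar> \<le> norm x" by (rule component_le_norm_cart)
        then show ?thesis using R(2)[OF x] by linarith
      qed
      then show "x \<in> cube b (2 * R)" by (simp add: cube_def b_def)
    qed
    have "cube b (2 * R) \<subseteq> cube (\<chi> i. b $ i - 2 * R) (4 * (2 * R))"
      using R(1) by (intro cube_subset_concentric) simp
    then have "cube (\<chi> i. b $ i - 2 * R) (4 * (2 * R)) \<inter> E \<noteq> {}" using sub e by blast
    from near[OF _ this] R(1)
    obtain \<rho> where "cube_average (cube b (2 * R)) (infdist_weight E \<alpha>) \<le> ennreal (K * \<rho> powr (- \<alpha>))"
      by auto
    \<comment> \<open>The cube has finite measure, so an infinite integral would make the average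
      infinite.\<close>
    then have "cube_average (cube b (2 * R)) (infdist_weight E \<alpha>) \<noteq> \<infinity>" by (auto simp: top_unique)
    then have fin: "(\<integral>\<^sup>+x\<in>cube b (2 * R). infdist_weight E \<alpha> x \<partial>lebesgue) \<noteq> \<infinity>"
      by (auto simp: cube_average_def emeasure_eq_measure2[OF cube_lmeasurable] ennreal_top_divide
          simp del: emeasure_completion)
    have "(\<integral>\<^sup>+x\<in>A. infdist_weight E \<alpha> x \<partial>lebesgue) \<le> (\<integral>\<^sup>+x\<in>cube b (2 * R). infdist_weight E \<alpha> x \<partial>lebesgue)"
      using sub by (intro nn_integral_mono mult_left_mono) (auto simp: indicator_def)
    also have "\<dots> < \<infinity>" using fin by (simp add: less_top)
    finally show "(\<integral>\<^sup>+x\<in>A. infdist_weight E \<alpha> x \<partial>lebesgue) < \<infinity>" .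
  qed
  moreover have "cube_average Q (infdist_weight E \<alpha>) *
      ennpowr (cube_average Q (\<lambda>x. ennpowr (infdist_weight E \<alpha> x) (- 1 / (p - 1)))) (p - 1) \<le> ennreal M"
    if "Q \<in> cubes" for Q
  proof -
    obtain b s where Q: "Q = cube b s" "s > 0" using \<open>Q \<in> cubes\<close> by (auto simp: cubes_def)
    show ?thesis
    proof (cases "cube (\<chi> i. b $ i - s) (4 * s) \<inter> E = {}")
      case True
      obtain \<rho> where \<rho>: "\<rho> > 0"
        "cube_average Q (infdist_weight E \<alpha>) \<le> ennreal (N powr \<alpha> * \<rho> powr (- \<alpha>))"
        "cube_average Q (\<lambda>x. ennreal (infdist x E powr (\<alpha> / (p - 1)))) \<le>
          ennreal (N powr (\<alpha> / (p - 1)) * \<rho> powr (\<alpha> / (p - 1)))"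
        using averages_far[OF assms(2) Q(2) True \<alpha>(1), of "\<alpha> / (p - 1)"] \<alpha>(1) p
        unfolding Q(1) N_def by auto
      show ?thesis
        unfolding ennpowr_infdist_weight[OF \<alpha>(1) p]
        by (rule order_trans[OF averages_product_le[OF p \<rho>(1) _ _ \<rho>(2,3)]])
          (use N in \<open>auto simp: M_def intro!: ennreal_leI\<close>)
    next
      case False
      obtain \<rho> where \<rho>: "\<rho> > 0"
        "cube_average Q (infdist_weight E \<alpha>) \<le> ennreal (K * \<rho> powr (- \<alpha>))"
        "cube_average Q (\<lambda>x. ennreal (infdist x E powr (\<alpha> / (p - 1)))) \<le>
          ennreal (K' * \<rho> powr (\<alpha> / (p - 1)))"
        using near[OF Q(2) False] unfolding Q(1) by auto
      show ?thesis
        unfolding ennpowr_infdist_weight[OF \<alpha>(1) p]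
        using averages_product_le[OF p \<rho>(1) K \<rho>(2,3)]
        by (rule order_trans) (auto simp: M_def intro!: ennreal_leI)
    qed
  qed
  moreover have "M > 0" using K by (simp add: M_def less_max_iff_disj)
  ultimately show "infdist_weight E \<alpha> \<in> Muckenhoupt p"
    unfolding Muckenhoupt_def by blast
qed

end
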